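(* Let $M$ be a monoid with monoid presentation $\langle X_M : R_M\rangle$ via a surjective morphism $\phi_M:X_M^*\to M$, and write $\overline w=w\phi_M$ for $w\in X_M^*$. Let $n\ge 0$. Let $X$ be the alphabet $$X=\{s_1,\ldots,s_{n-1}\}\cup\{e_1,\ldots,e_n\}\cup\{x^{(i)}: x\in X_M,\ 1\le i\le n\}$$ (all listed letters being distinct), and for a word $w=x_1\cdots x_k\in X_M^*$ and $1\le i\le n$ put $w^{(i)}=x_1^{(i)}\cdots x_k^{(i)}\in X^*$ (the empty word $\iota$ if $k=0$). Let $R$ be the following set of relations over $X$, where $x,y\in X_M$ and all subscripts and superscripts range over all values for which the letters are defined, subject to the stated constraints: (1) $s_i^2=\iota$; (2) $s_is_j=s_js_i$ if $|i-j|>1$; (3) $s_is_js_i=s_js_is_j$ if $|i-j|=1$; (4) $e_i^2=e_i$; (5) $e_ie_j=e_je_i$; (6) $s_ie_j=e_js_i$ if $j\ne i,i+1$; (7) $s_ie_i=e_{i+1}s_i$; (8) $e_ie_{i+1}s_i=e_ie_{i+1}$; (9) $u^{(i)}=v^{(i)}$ for all $(u,v)\in R_M$ and $1\le i\le n$; (10) $x^{(i)}y^{(j)}=y^{(j)}x^{(i)}$ if $i\neq j$; (11) $s_ix^{(j)}=x^{(j)}s_i$ if $j\ne i,i+1$; (12) $s_ix^{(i)}=x^{(i+1)}s_i$; (13) $e_ix^{(j)}=x^{(j)}e_i$ if $i\ne j$; (14) $e_ix^{(i)}=e_i=x^{(i)}e_i$. Let $\phi:X^*\to M\wr\mathcal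 I_n$ be the monoid morphism determined by - $s_i\mapsto ((1,\ldots,1),(i,i+1))$, where $(i,i+1)$ is the transposition swapping $i$ and $i+1$; - $e_i\mapsto((1,\ldots,1,0,1,\ldots,1),\mathrm{id}_{\{1,\ldots,n\}\setminus\{i\}})$, with $0$ in position $i$; - $x^{(i)}\mapsto((1,\ldots,1,\overline x,1,\ldots,1),\mathrm{id}_{\{1,\ldots,n\}})$, with $\overline x$ in position $i$. Then the wreath product $M\wr\mathcal I_n$ has monoid presentation $\langle X:R\rangle$ via $\phi$.
   Context: Write $\mathbf n=\{1,\ldots,n\}$ (empty if $n=0$). The symmetric inverse monoid $\mathcal I_n$ is the monoid of all injective partial maps $\mathbf n\to\mathbf n$ under composition of partial maps, composed left to right ($i(\alpha\beta)=(i\alpha)\beta$). For $A\subseteq\mathbf n$, $\mathrm{id}_A\in\mathcal I_n$ is the identity map on $A$. $M_0=M\cup\{0\}$ is obtained from $M$ (with identity $1$) by adjoining a new symbol $0$ as a zero element (even if $M$ already has a zero). $M_0^n$ is the direct power (componentwise product). For $\mathbf a=(a_1,\ldots,a_n)\in M_0^n$, $\mathrm{supp}(\mathbf a)=\{i\in\mathbf n:a_i\ne0\}$. For $\alpha\in\mathcal I_n$ and $\mathbf a\in M_0^n$, ${}^\alpha\mathbf a=(b_1,\ldots,b_n)$ where $b_i=a_{i\alpha}$ if $i\in\mathrm{dom}(\alpha)$ and $b_i=0$ otherwise. The wreath product is the monoid $$M\wr\mathcal I_n=\{(\mathbf a,\alpha)\in M_0^n\times\mathcal I_n:\mathrm{supp}(\mathbf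 a)=\mathrm{dom}(\alpha)\},\qquad (\mathbf a,\alpha)(\mathbf b,\beta)=(\mathbf a\cdot{}^\alpha\mathbf b,\ \alpha\beta).$$ Presentations: $X^*$ is the free monoid over $X$. For $R\subseteq X^*\times X^*$, $R^\sharp$ denotes the congruence on $X^*$ generated by $R$; a relation $(u,v)$ is written $u=v$. A monoid $N$ has monoid presentation $\langle X:R\rangle$ via $\phi$ if $\phi:X^*\to N$ is a surjective monoid morphism whose kernel $\{(u,v):u\phi=v\phi\}$ equals $R^\sharp$. *)

theory Defs
  imports "HOL-Algebra.Product_Groups" "HOL-Combinatorics.Transposition"
begin

section \<open>Monoid presentations\<close>

definition free_monoid :: "'a set \<Rightarrow> 'a list monoid" where
  "free_monoid X = \<lparr>carrier = lists X, monoid.mult = (@), one = []\<rparr>"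

text \<open>The library's \<^const>\<open>hom\<close> is the set of semigroup morphisms; preservation of the
  identity is not automatic for monoids.\<close>

definition monoid_hom :: "('a, 'b) monoid_scheme \<Rightarrow> ('c, 'd) monoid_scheme \<Rightarrow> ('a \<Rightarrow> 'c) set" where
  "monoid_hom G H = {h \<in> hom G H. h \<one>\<^bsub>G\<^esub> = \<one>\<^bsub>H\<^esub>}"

definition monoid_congruence :: "('a, 'b) monoid_scheme \<Rightarrow> ('a \<times> 'a) set \<Rightarrow> bool" where
  "monoid_congruence G E \<longleftrightarrow> equiv (carrier G) E \<and>
     (\<forall>a b c d. (a, b) \<in> E \<longrightarrow> (c, d) \<in> E \<longrightarrow> (a \<otimes>\<^bsub>G\<^esub> c, b \<otimes>\<^bsub>G\<^esub> d) \<in> E)"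

definition generated_congruence ::
    "('a, 'b) monoid_scheme \<Rightarrow> ('a \<times> 'a) set \<Rightarrow> ('a \<times> 'a) set" where
  "generated_congruence G R = \<Inter>{E. monoid_congruence G E \<and> R \<subseteq> E}"

definition monoid_kernel :: "('a, 'b) monoid_scheme \<Rightarrow> ('a \<Rightarrow> 'c) \<Rightarrow> ('a \<times> 'a) set" where
  "monoid_kernel G h = {(u, v). u \<in> carrier G \<and> v \<in> carrier G \<and> h u = h v}"

definition has_presentation ::
    "('a, 'b) monoid_scheme \<Rightarrow> 'x set \<Rightarrow> ('x list \<times> 'x list) set \<Rightarrow> ('x list \<Rightarrow> 'a) \<Rightarrow> bool" where
  "has_presentation N X R \<phi> \<longleftrightarrow>
     monoid N \<and> R \<subseteq> lists X \<times> lists X \<and>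
     \<phi> \<in> monoid_hom (free_monoid X) N \<and> \<phi> ` lists X = carrier N \<and>
     monoid_kernel (free_monoid X) \<phi> = generated_congruence (free_monoid X) R"

definition free_extension :: "('a, 'b) monoid_scheme \<Rightarrow> ('x \<Rightarrow> 'a) \<Rightarrow> 'x list \<Rightarrow> 'a" where
  "free_extension N f w = foldr (\<lambda>x y. f x \<otimes>\<^bsub>N\<^esub> y) w \<one>\<^bsub>N\<^esub>"

lemma free_extension_closed:
  assumes "monoid N" and "\<And>x. x \<in> X \<Longrightarrow> f x \<in> carrier N" and "w \<in> lists X"
  shows "free_extension N f w \<in> carrier N"
proof -
  interpret monoid N by fact
  show ?thesis using assms(3)
    by (induction w) (auto simp: free_extension_def assms(2))
qed

lemma free_extension_monoid_hom:
  assumes "monoid N" and f: "\<And>x. x \<in> X \<Longrightarrow> f x \<in> carrier N"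
  shows "free_extension N f \<in> monoid_hom (free_monoid X) N"
    and "\<And>x. x \<in> X \<Longrightarrow> free_extension N f [x] = f x"
proof -
  interpret monoid N by fact
  note cl = free_extension_closed[OF assms(1), of X f, OF f]
  have "free_extension N f (u @ v) = free_extension N f u \<otimes>\<^bsub>N\<^esub> free_extension N f v"
    if "u \<in> lists X" "v \<in> lists X" for u v
    using that
  proof (induction u)
    case Nil
    then show ?case using cl[of v] by (simp add: free_extension_def)
  next
    case (Cons x u)
    then show ?case using cl[of u] cl[of v] f[of x] m_assoc
      by (simp add: free_extension_def)
  qed
  then show "free_extension N f \<in> monoid_hom (free_monoid X) N"
    using cl by (auto simp: monoid_hom_def hom_def free_monoid_def free_extension_def[of N f "[]"])
  show "free_extension N f [x] = f x" if "x \<in> X" for x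
    using f[OF that] by (simp add: free_extension_def)
qed

lemma free_extension_unique:
  assumes "h \<in> monoid_hom (free_monoid X) N" and "\<And>x. x \<in> X \<Longrightarrow> h [x] = f x"
    and "w \<in> lists X"
  shows "h w = free_extension N f w"
  using assms(3)
proof (induction w)
  case Nil
  then show ?case
    using assms(1) by (simp add: monoid_hom_def free_monoid_def free_extension_def)
next
  case (Cons x w)
  have "[x] \<in> lists X" using Cons.hyps by simp
  moreover have "\<forall>u\<in>lists X. \<forall>v\<in>lists X. h (u @ v) = h u \<otimes>\<^bsub>N\<^esub> h v"
    using assms(1) by (simp add: monoid_hom_def hom_def free_monoid_def)
  ultimately have "h ([x] @ w) = h [x] \<otimes>\<^bsub>N\<^esub> h w"
    using Cons.hyps by blast
  then show ?case
    using Cons assms(2) by (simp add: free_extension_def)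
qed

section \<open>The symmetric inverse monoid\<close>

text \<open>Partial maps compose left to right: the product of \<open>\<alpha>\<close> and \<open>\<beta>\<close> applies \<open>\<alpha>\<close> first.\<close>

definition sym_inv_monoid :: "nat \<Rightarrow> (nat \<rightharpoonup> nat) monoid" where
  "sym_inv_monoid n = \<lparr>carrier = {\<alpha>. dom \<alpha> \<subseteq> {1..n} \<and> ran \<alpha> \<subseteq> {1..n} \<and> inj_on \<alpha> (dom \<alpha>)},
                       monoid.mult = (\<lambda>\<alpha> \<beta>. \<beta> \<circ>\<^sub>m \<alpha>),
                       one = Some |` {1..n}\<rparr>"

section \<open>The wreath product\<close>

definition adjoin_zero :: "('m, 'k) monoid_scheme \<Rightarrow> 'm option monoid" where
  "adjoin_zero M = \<lparr>carrier = insert None (Some ` carrier M),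
                    monoid.mult = (\<lambda>a b. case (a, b) of
                        (Some x, Some y) \<Rightarrow> Some (x \<otimes>\<^bsub>M\<^esub> y)
                      | _ \<Rightarrow> None),
                    one = Some \<one>\<^bsub>M\<^esub>\<rparr>"

abbreviation zero_power :: "('m, 'k) monoid_scheme \<Rightarrow> nat \<Rightarrow> (nat \<Rightarrow> 'm option) monoid" where
  "zero_power M n \<equiv> product_group {1..n} (\<lambda>_. adjoin_zero M)"

definition support :: "nat \<Rightarrow> (nat \<Rightarrow> 'm option) \<Rightarrow> nat set" where
  "support n a = {i \<in> {1..n}. a i \<noteq> None}"

definition act :: "nat \<Rightarrow> (nat \<rightharpoonup> nat) \<Rightarrow> (nat \<Rightarrow> 'm option) \<Rightarrow> nat \<Rightarrow> 'm option" where
  "act n \<alpha> a = (\<lambda>i\<in>{1..n}. case \<alpha> i of None \<Rightarrow> None | Some j \<Rightarrow> a j)"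

definition wreath ::
    "('m, 'k) monoid_scheme \<Rightarrow> nat \<Rightarrow> ((nat \<Rightarrow> 'm option) \<times> (nat \<rightharpoonup> nat)) monoid" where
  "wreath M n =
     \<lparr>carrier = {(a, \<alpha>). a \<in> carrier (zero_power M n) \<and> \<alpha> \<in> carrier (sym_inv_monoid n) \<and>
                         support n a = dom \<alpha>},
      monoid.mult = (\<lambda>(a, \<alpha>) (b, \<beta>).
        (a \<otimes>\<^bsub>zero_power M n\<^esub> act n \<alpha> b, \<alpha> \<otimes>\<^bsub>sym_inv_monoid n\<^esub> \<beta>)),
      one = (\<one>\<^bsub>zero_power M n\<^esub>, \<one>\<^bsub>sym_inv_monoid n\<^esub>)\<rparr>"

section \<open>Generators and relations\<close>

text \<open>\<open>XL x i\<close> is the letter $x^{(i)}$.\<close>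

datatype 'x letter = SL nat | EL nat | XL 'x nat

definition wreath_alphabet :: "nat \<Rightarrow> 'x set \<Rightarrow> 'x letter set" where
  "wreath_alphabet n X = SL ` {1..<n} \<union> EL ` {1..n} \<union> {XL x i | x i. x \<in> X \<and> i \<in> {1..n}}"

definition word_at :: "nat \<Rightarrow> 'x list \<Rightarrow> 'x letter list" where
  "word_at i w = map (\<lambda>x. XL x i) w"

inductive_set wreath_relations ::
    "nat \<Rightarrow> 'x set \<Rightarrow> ('x list \<times> 'x list) set \<Rightarrow> ('x letter list \<times> 'x letter list) set"
  for n :: nat and X :: "'x set" and R :: "('x list \<times> 'x list) set" where
  R1: "i \<in> {1..<n} \<Longrightarrow> ([SL i, SL i], []) \<in> wreath_relations n X R"
| R2: "i \<in> {1..<n} \<Longrightarrow> j \<in> {1..<n} \<Longrightarrow> \<bar>int i - int j\<bar> > 1 \<Longrightarrow>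
    ([SL i, SL j], [SL j, SL i]) \<in> wreath_relations n X R"
| R3: "i \<in> {1..<n} \<Longrightarrow> j \<in> {1..<n} \<Longrightarrow> \<bar>int i - int j\<bar> = 1 \<Longrightarrow>
    ([SL i, SL j, SL i], [SL j, SL i, SL j]) \<in> wreath_relations n X R"
| R4: "i \<in> {1..n} \<Longrightarrow> ([EL i, EL i], [EL i]) \<in> wreath_relations n X R"
| R5: "i \<in> {1..n} \<Longrightarrow> j \<in> {1..n} \<Longrightarrow>
    ([EL i, EL j], [EL j, EL i]) \<in> wreath_relations n X R"
| R6: "i \<in> {1..<n} \<Longrightarrow> j \<in> {1..n} \<Longrightarrow> j \<noteq> i \<Longrightarrow> j \<noteq> i + 1 \<Longrightarrow>
    ([SL i, EL j], [EL j, SL i]) \<in> wreath_relations n X R"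
| R7: "i \<in> {1..<n} \<Longrightarrow> ([SL i, EL i], [EL (i + 1), SL i]) \<in> wreath_relations n X R"
| R8: "i \<in> {1..<n} \<Longrightarrow>
    ([EL i, EL (i + 1), SL i], [EL i, EL (i + 1)]) \<in> wreath_relations n X R"
| R9: "(u, v) \<in> R \<Longrightarrow> i \<in> {1..n} \<Longrightarrow> (word_at i u, word_at i v) \<in> wreath_relations n X R"
| R10: "x \<in> X \<Longrightarrow> y \<in> X \<Longrightarrow> i \<in> {1..n} \<Longrightarrow> j \<in> {1..n} \<Longrightarrow> i \<noteq> j \<Longrightarrow>
    ([XL x i, XL y j], [XL y j, XL x i]) \<in> wreath_relations n X R"
| R11: "x \<in> X \<Longrightarrow> i \<in> {1..<n} \<Longrightarrow> j \<in> {1..n} \<Longrightarrow> j \<noteq> i \<Longrightarrow> j \<noteq> i + 1 \<Longrightarrow>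
    ([SL i, XL x j], [XL x j, SL i]) \<in> wreath_relations n X R"
| R12: "x \<in> X \<Longrightarrow> i \<in> {1..<n} \<Longrightarrow>
    ([SL i, XL x i], [XL x (i + 1), SL i]) \<in> wreath_relations n X R"
| R13: "x \<in> X \<Longrightarrow> i \<in> {1..n} \<Longrightarrow> j \<in> {1..n} \<Longrightarrow> i \<noteq> j \<Longrightarrow>
    ([EL i, XL x j], [XL x j, EL i]) \<in> wreath_relations n X R"
| R14_left: "x \<in> X \<Longrightarrow> i \<in> {1..n} \<Longrightarrow> ([EL i, XL x i], [EL i]) \<in> wreath_relations n X R"
| R14_right: "x \<in> X \<Longrightarrow> i \<in> {1..n} \<Longrightarrow> ([EL i], [XL x i, EL i]) \<in> wreath_relations n X R"

fun letter_image ::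
    "('m, 'k) monoid_scheme \<Rightarrow> nat \<Rightarrow> ('x list \<Rightarrow> 'm) \<Rightarrow> 'x letter
      \<Rightarrow> (nat \<Rightarrow> 'm option) \<times> (nat \<rightharpoonup> nat)" where
  "letter_image M n \<phi> (SL i) =
     ((\<lambda>k\<in>{1..n}. Some \<one>\<^bsub>M\<^esub>), (Some \<circ> transpose i (i + 1)) |` {1..n})"
| "letter_image M n \<phi> (EL i) =
     ((\<lambda>k\<in>{1..n}. if k = i then None else Some \<one>\<^bsub>M\<^esub>), Some |` ({1..n} - {i}))"
| "letter_image M n \<phi> (XL x i) =
     ((\<lambda>k\<in>{1..n}. Some (if k = i then \<phi> [x] else \<one>\<^bsub>M\<^esub>)), Some |` {1..n})"

definition wreath_map ::
    "('m, 'k) monoid_scheme \<Rightarrow> nat \<Rightarrow> ('x list \<Rightarrow> 'm) \<Rightarrow> 'x letter list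
      \<Rightarrow> (nat \<Rightarrow> 'm option) \<times> (nat \<rightharpoonup> nat)" where
  "wreath_map M n \<phi> = free_extension (wreath M n) (letter_image M n \<phi>)"

end

theory Submission
  imports Defs "HOL-Combinatorics.Permutations"
begin

text \<open>
  A word over the wreath alphabet is a diagram of strands: the strand that starts at \<^term>\<open>i\<close> is
  moved by the letters \<^term>\<open>SL k\<close>, cut by the letters \<^term>\<open>EL k\<close>, and collects the
  letters \<^term>\<open>XL x k\<close> that it meets. Lemma \<open>wreath_map_eq_strand\<close> identifies the image
  of a word under the morphism of the theorem with this diagram: entry \<^term>\<open>i\<close> of the tuple is the
  value in the monoid of the word collected by strand \<^term>\<open>i\<close>, and the partial permutation
  sends \<^term>\<open>i\<close> to the end of the strand. Each relation visibly preserves the diagram up to equality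
  of the collected words in the monoid, and this is soundness.

  For completeness, a word is first brought into the form \<open>p @ \<sigma>\<close>, where \<open>p\<close> is
  diagonal (it has letters \<^term>\<open>EL k\<close> and \<^term>\<open>XL x k\<close> only) and \<open>\<sigma>\<close> has
  letters \<^term>\<open>SL k\<close> only (\<open>factorization\<close>). Three facts then show that \<open>p @ \<sigma>\<close>
  and \<open>q @ \<tau>\<close> are equivalent when they have the same image.
  (i) Diagonal letters at different positions commute and \<^term>\<open>EL k\<close> absorbs the letters at
  position \<^term>\<open>k\<close>. So \<open>p\<close> is determined by the set of positions that it
  cuts and, at every other position, by a word that matters only through its value in the given
  monoid (\<open>diagonal_eqv\<close>). Hence \<open>p\<close> and \<open>q\<close> are equivalent.
  (ii) The relations between the letters \<^term>\<open>SL k\<close> present the symmetric group: a word of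
  this kind whose permutation is the identity is equivalent to the empty word
  (\<open>identity_word\<close>).
  (iii) If \<open>\<sigma>\<close> and \<open>\<tau>\<close> agree on the uncut positions, then \<open>\<sigma> @ rev \<tau>\<close> permutes
  the cut positions only. Such a permutation is a product of transpositions of two cut positions,
  and these are absorbed by \<open>q\<close>, as follows from the relation that lets two adjacent cuts absorb the
  transposition between them (\<open>absorbs_permutation\<close>). So \<open>q @ \<sigma>\<close> is equivalent
  to \<open>q @ \<tau>\<close>.

  Surjectivity uses the same shape: a diagonal word realises any tuple, and the partial
  permutation extends to a permutation of all positions, which is a product of adjacent
  transpositions.
\<close>


section \<open>Congruences and presentations\<close>

lemma monoid_free_monoid: "monoid (free_monoid X)"
  by unfold_locales (auto simp: free_monoid_def)

lemma carrier_free_monoid: "carrier (free_monoid X) = lists X"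
  by (simp add: free_monoid_def)

lemma monoid_kernel_congruence:
  assumes "monoid G" and "h \<in> monoid_hom G H"
  shows "monoid_congruence G (monoid_kernel G h)"
proof -
  interpret monoid G by fact
  show ?thesis
    using assms(2)
    by (auto simp: monoid_congruence_def monoid_kernel_def monoid_hom_def hom_def
        intro!: equivI refl_onI symI transI)
qed

lemma
  assumes "monoid_congruence G E"
  shows monoid_congruence_subset: "E \<subseteq> carrier G \<times> carrier G"
    and monoid_congruence_refl: "a \<in> carrier G \<Longrightarrow> (a, a) \<in> E"
    and monoid_congruence_sym: "(a, b) \<in> E \<Longrightarrow> (b, a) \<in> E"
    and monoid_congruence_trans: "(a, b) \<in> E \<Longrightarrow> (b, c) \<in> E \<Longrightarrow> (a, c) \<in> E"
    and monoid_congruence_mult: "(a, b) \<in> E \<Longrightarrow> (c, d) \<in> E \<Longrightarrow> (a \<otimes>\<^bsub>G\<^esub> c, b \<otimes>\<^bsub>G\<^esub> d) \<in> E"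
proof -
  have e: "E \<subseteq> carrier G \<times> carrier G" "refl_on (carrier G) E" "sym E" "trans E"
    using assms unfolding monoid_congruence_def equiv_def by blast+
  show "E \<subseteq> carrier G \<times> carrier G" by (fact e)
  show "a \<in> carrier G \<Longrightarrow> (a, a) \<in> E" using e(2) by (rule refl_onD)
  show "(a, b) \<in> E \<Longrightarrow> (b, a) \<in> E" using e(3) by (rule symD)
  show "(a, b) \<in> E \<Longrightarrow> (b, c) \<in> E \<Longrightarrow> (a, c) \<in> E" using e(4) by (rule transD)
  show "(a, b) \<in> E \<Longrightarrow> (c, d) \<in> E \<Longrightarrow> (a \<otimes>\<^bsub>G\<^esub> c, b \<otimes>\<^bsub>G\<^esub> d) \<in> E"
    using assms unfolding monoid_congruence_def by blast
qed

lemma monoid_congruence_generated: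
  assumes "monoid G" and "R \<subseteq> carrier G \<times> carrier G"
  shows "monoid_congruence G (generated_congruence G R)"
proof -
  interpret monoid G by fact
  \<comment> \<open>The total relation shows that the intersection is not taken over the empty family.\<close>
  have tot: "monoid_congruence G (carrier G \<times> carrier G)"
    unfolding monoid_congruence_def
    by (intro conjI equivI refl_onI symI transI allI impI) auto
  have D: "(a, b) \<in> E"
    if "(a, b) \<in> generated_congruence G R" "monoid_congruence G E" "R \<subseteq> E" for a b E
    using that unfolding generated_congruence_def by blast
  have I: "(a, b) \<in> generated_congruence G R"
    if "\<And>E. monoid_congruence G E \<Longrightarrow> R \<subseteq> E \<Longrightarrow> (a, b) \<in> E" for a b
    unfolding generated_congruence_def by (rule InterI) (elim CollectE conjE, rule that)
  show ?thesis
    unfolding monoid_congruence_def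
  proof (intro conjI allI impI equivI)
    show "generated_congruence G R \<subseteq> carrier G \<times> carrier G"
      by (rule subrelI) (rule D[OF _ tot assms(2)])
    show "refl_on (carrier G) (generated_congruence G R)"
      by (rule refl_onI, rule I, rule monoid_congruence_refl)
    show "sym (generated_congruence G R)"
    proof (intro symI I)
      fix a b E assume "(a, b) \<in> generated_congruence G R" "monoid_congruence G E" "R \<subseteq> E"
      then show "(b, a) \<in> E" using monoid_congruence_sym[OF _ D[of a b E]] by blast
    qed
    show "trans (generated_congruence G R)"
    proof (intro transI I)
      fix a b c E assume "(a, b) \<in> generated_congruence G R" "(b, c) \<in> generated_congruence G R"
        "monoid_congruence G E" "R \<subseteq> E"
      then show "(a, c) \<in> E" using monoid_congruence_trans[OF _ D[of a b E] D[of b c E]] by blast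
    qed
    show "(a \<otimes>\<^bsub>G\<^esub> c, b \<otimes>\<^bsub>G\<^esub> d) \<in> generated_congruence G R"
      if "(a, b) \<in> generated_congruence G R" "(c, d) \<in> generated_congruence G R" for a b c d
    proof (rule I)
      fix E assume "monoid_congruence G E" "R \<subseteq> E"
      then show "(a \<otimes>\<^bsub>G\<^esub> c, b \<otimes>\<^bsub>G\<^esub> d) \<in> E"
        using monoid_congruence_mult[of G E, OF _ D[OF that(1)] D[OF that(2)]] by blast
    qed
  qed
qed

lemma generated_congruence_least:
  "monoid_congruence G E \<Longrightarrow> R \<subseteq> E \<Longrightarrow> generated_congruence G R \<subseteq> E"
  by (auto simp: generated_congruence_def)

lemma generated_congruence_base: "R \<subseteq> generated_congruence G R"
  by (auto simp: generated_congruence_def)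


section \<open>The wreath product as a monoid\<close>

lemma restrict_map_Some [simp]: "(Some |` A) i = (if i \<in> A then Some i else None)"
  by (simp add: restrict_map_def)

lemma ran_partial_identity: "ran (Some |` A) = A"
  by (auto simp: ran_def restrict_map_def)

lemma inj_on_partial_identity: "inj_on (Some |` A) A"
  by (simp add: inj_on_def)

lemma ran_restrict_map_iff: "j \<in> ran ((Some \<circ> f) |` A) \<longleftrightarrow> (\<exists>i\<in>A. f i = j)"
  by (auto simp: ran_def restrict_map_def)

lemma carrier_wreath_iff:
  "(a, \<alpha>) \<in> carrier (wreath M n) \<longleftrightarrow>
     a \<in> extensional {1..n} \<and> (\<forall>i\<in>{1..n}. a i \<in> insert None (Some ` carrier M)) \<and>
     (\<forall>i\<in>{1..n}. a i = None \<longleftrightarrow> \<alpha> i = None) \<and>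
     dom \<alpha> \<subseteq> {1..n} \<and> ran \<alpha> \<subseteq> {1..n} \<and> inj_on \<alpha> (dom \<alpha>)"
proof -
  have "support n a = dom \<alpha> \<longleftrightarrow> (\<forall>i. i \<in> {1..n} \<and> a i \<noteq> None \<longleftrightarrow> \<alpha> i \<noteq> None)"
    unfolding support_def dom_def set_eq_iff mem_Collect_eq ..
  also have "\<dots> \<longleftrightarrow> dom \<alpha> \<subseteq> {1..n} \<and> (\<forall>i\<in>{1..n}. a i = None \<longleftrightarrow> \<alpha> i = None)"
    unfolding dom_def subset_iff mem_Collect_eq by metis
  finally have support: "support n a = dom \<alpha> \<longleftrightarrow>
    dom \<alpha> \<subseteq> {1..n} \<and> (\<forall>i\<in>{1..n}. a i = None \<longleftrightarrow> \<alpha> i = None)" .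
  have weights: "a \<in> carrier (zero_power M n) \<longleftrightarrow>
      a \<in> extensional {1..n} \<and> (\<forall>i\<in>{1..n}. a i \<in> insert None (Some ` carrier M))"
    unfolding carrier_product_group PiE_iff adjoin_zero_def partial_object.simps
    by (rule conj_commute)
  have maps: "\<alpha> \<in> carrier (sym_inv_monoid n) \<longleftrightarrow>
      dom \<alpha> \<subseteq> {1..n} \<and> ran \<alpha> \<subseteq> {1..n} \<and> inj_on \<alpha> (dom \<alpha>)"
    by (simp add: sym_inv_monoid_def)
  have wreath: "(a, \<alpha>) \<in> carrier (wreath M n) \<longleftrightarrow>
      a \<in> carrier (zero_power M n) \<and> \<alpha> \<in> carrier (sym_inv_monoid n) \<and> support n a = dom \<alpha>"
    by (simp add: wreath_def)
  show ?thesis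
    unfolding wreath support weights maps by (intro iffI conjI; elim conjE; assumption)
qed

text \<open>In the option monad the product needs no case distinctions, so that associativity is a matter of
  following one index through both sides.\<close>

lemma wreath_mult:
  "(a, \<alpha>) \<otimes>\<^bsub>wreath M n\<^esub> (b, \<beta>) =
     ((\<lambda>i\<in>{1..n}. Option.bind (a i) (\<lambda>x. Option.bind (\<alpha> i) (\<lambda>j. map_option (\<lambda>y. x \<otimes>\<^bsub>M\<^esub> y) (b j)))),
      \<beta> \<circ>\<^sub>m \<alpha>)"
  by (auto simp: wreath_def adjoin_zero_def sym_inv_monoid_def act_def fun_eq_iff split: option.splits)

lemma wreath_one: "\<one>\<^bsub>wreath M n\<^esub> = ((\<lambda>i\<in>{1..n}. Some \<one>\<^bsub>M\<^esub>), Some |` {1..n})"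
  by (simp add: wreath_def adjoin_zero_def sym_inv_monoid_def)

lemma monoid_wreath:
  assumes "monoid M"
  shows "monoid (wreath M n)"
proof -
  interpret monoid M by fact
  have inj_comp: "inj_on (\<beta> \<circ>\<^sub>m \<alpha>) (dom (\<beta> \<circ>\<^sub>m \<alpha>))"
    if "inj_on \<alpha> (dom \<alpha>)" "inj_on \<beta> (dom \<beta>)" for \<alpha> \<beta> :: "nat \<rightharpoonup> nat"
  proof (rule inj_onI)
    fix i j assume "i \<in> dom (\<beta> \<circ>\<^sub>m \<alpha>)" "j \<in> dom (\<beta> \<circ>\<^sub>m \<alpha>)" "(\<beta> \<circ>\<^sub>m \<alpha>) i = (\<beta> \<circ>\<^sub>m \<alpha>) j"
    then obtain i' j' k where *: "\<alpha> i = Some i'" "\<alpha> j = Some j'" "\<beta> i' = Some k" "\<beta> j' = Some k"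
      by (auto simp: map_comp_def split: option.splits)
    then have "i' = j'" using that(2) by (metis domI inj_onD)
    with * show "i = j" using that(1) by (metis domI inj_onD)
  qed
  show ?thesis
  proof (rule monoidI)
    fix p q assume "p \<in> carrier (wreath M n)" "q \<in> carrier (wreath M n)"
    moreover obtain a \<alpha> b \<beta> where pq: "p = (a, \<alpha>)" "q = (b, \<beta>)" by fastforce
    ultimately have p: "(a, \<alpha>) \<in> carrier (wreath M n)" and q: "(b, \<beta>) \<in> carrier (wreath M n)" by auto
    show "p \<otimes>\<^bsub>wreath M n\<^esub> q \<in> carrier (wreath M n)"
      unfolding pq wreath_mult carrier_wreath_iff
    proof (intro conjI ballI)
      let ?c = "\<lambda>i\<in>{1..n}. Option.bind (a i)
        (\<lambda>x. Option.bind (\<alpha> i) (\<lambda>j. map_option (\<lambda>y. x \<otimes>\<^bsub>M\<^esub> y) (b j)))"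
      fix i assume i: "i \<in> {1..n}"
      then have ai: "a i \<in> insert None (Some ` carrier M)" "a i = None \<longleftrightarrow> \<alpha> i = None"
        using p unfolding carrier_wreath_iff by blast+
      have bj: "b j \<in> insert None (Some ` carrier M) \<and> (b j = None \<longleftrightarrow> \<beta> j = None)"
        if "\<alpha> i = Some j" for j
        using p q that unfolding carrier_wreath_iff ran_def by blast
      show "?c i \<in> insert None (Some ` carrier M)" "?c i = None \<longleftrightarrow> (\<beta> \<circ>\<^sub>m \<alpha>) i = None"
        using i ai bj by (cases "\<alpha> i"; auto)+
    next
      show "inj_on (\<beta> \<circ>\<^sub>m \<alpha>) (dom (\<beta> \<circ>\<^sub>m \<alpha>))"
        using p q inj_comp unfolding carrier_wreath_iff by blast
      show "dom (\<beta> \<circ>\<^sub>m \<alpha>) \<subseteq> {1..n}"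
        using p unfolding carrier_wreath_iff by (auto simp: map_comp_def split: option.splits)
      show "ran (\<beta> \<circ>\<^sub>m \<alpha>) \<subseteq> {1..n}"
      proof
        fix k assume "k \<in> ran (\<beta> \<circ>\<^sub>m \<alpha>)"
        then have "k \<in> ran \<beta>"
          unfolding ran_def map_comp_def by (auto split: option.splits)
        then show "k \<in> {1..n}" using q unfolding carrier_wreath_iff by blast
      qed
    qed simp
  next
    show "\<one>\<^bsub>wreath M n\<^esub> \<in> carrier (wreath M n)"
      by (auto simp: wreath_one carrier_wreath_iff inj_on_def ran_def split: if_splits)
  next
    fix p q r assume "p \<in> carrier (wreath M n)" "q \<in> carrier (wreath M n)" "r \<in> carrier (wreath M n)"
    moreover obtain a \<alpha> b \<beta> c \<gamma> where pqr: "p = (a, \<alpha>)" "q = (b, \<beta>)" "r = (c, \<gamma>)"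
      by (metis surj_pair)
    ultimately have p: "(a, \<alpha>) \<in> carrier (wreath M n)" and q: "(b, \<beta>) \<in> carrier (wreath M n)"
      and r: "(c, \<gamma>) \<in> carrier (wreath M n)" by auto
    have "Option.bind
            (Option.bind (a i) (\<lambda>x. Option.bind (\<alpha> i) (\<lambda>j. map_option (\<lambda>y. x \<otimes>\<^bsub>M\<^esub> y) (b j))))
            (\<lambda>x. Option.bind ((\<beta> \<circ>\<^sub>m \<alpha>) i) (\<lambda>j. map_option (\<lambda>y. x \<otimes>\<^bsub>M\<^esub> y) (c j))) =
          Option.bind (a i) (\<lambda>x. Option.bind (\<alpha> i) (\<lambda>j. map_option (\<lambda>y. x \<otimes>\<^bsub>M\<^esub> y)
            (Option.bind (b j) (\<lambda>x. Option.bind (\<beta> j) (\<lambda>j. map_option (\<lambda>y. x \<otimes>\<^bsub>M\<^esub> y) (c j))))))"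
      if i: "i \<in> {1..n}" for i
    proof (cases "a i"; cases "\<alpha> i")
      fix x j assume a: "a i = Some x" "\<alpha> i = Some j"
      then have x: "x \<in> carrier M" and j: "j \<in> {1..n}"
        using p i unfolding carrier_wreath_iff ran_def by fastforce+
      show ?thesis
      proof (cases "b j"; cases "\<beta> j")
        fix y k assume b: "b j = Some y" "\<beta> j = Some k"
        then have y: "y \<in> carrier M" and k: "k \<in> {1..n}"
          using q j unfolding carrier_wreath_iff ran_def by fastforce+
        then have "z \<in> carrier M" if "c k = Some z" for z
          using r that unfolding carrier_wreath_iff by fastforce
        then show ?thesis using a b x y by (cases "c k") (auto simp: m_assoc)
      qed (use a in auto)
    qed auto
    moreover have "\<alpha> i = Some j \<Longrightarrow> j \<in> {1..n}" for i j
      using p unfolding carrier_wreath_iff ran_def by blast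
    ultimately show "p \<otimes>\<^bsub>wreath M n\<^esub> q \<otimes>\<^bsub>wreath M n\<^esub> r = p \<otimes>\<^bsub>wreath M n\<^esub> (q \<otimes>\<^bsub>wreath M n\<^esub> r)"
      unfolding pqr wreath_mult
      by (intro arg_cong2[where f = Pair] ext)
         (auto simp: map_comp_def restrict_def split: option.splits bind_split)
  next
    fix p assume "p \<in> carrier (wreath M n)"
    moreover obtain a \<alpha> where p0: "p = (a, \<alpha>)" by fastforce
    ultimately have p: "(a, \<alpha>) \<in> carrier (wreath M n)" by auto
    have range: "j \<in> {1..n}" if "\<alpha> i = Some j" for i j
      using p that unfolding carrier_wreath_iff ran_def by blast
    have dom: "\<alpha> i = None" if "i \<notin> {1..n}" for i
      using p that unfolding carrier_wreath_iff by blast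
    have ai: "a i = None \<longleftrightarrow> \<alpha> i = None" if "i \<in> {1..n}" for i
      using p that unfolding carrier_wreath_iff by blast
    have undef: "a i = undefined" if "i \<notin> {1..n}" for i
      using p that unfolding carrier_wreath_iff extensional_def by blast
    have cl: "x \<in> carrier M" if "i \<in> {1..n}" "a i = Some x" for i x
      using p that unfolding carrier_wreath_iff by fastforce
    show "\<one>\<^bsub>wreath M n\<^esub> \<otimes>\<^bsub>wreath M n\<^esub> p = p"
      unfolding p0 wreath_one wreath_mult
    proof (intro arg_cong2[where f = Pair] ext)
      fix i
      show "(\<lambda>i\<in>{1..n}. Option.bind ((\<lambda>i\<in>{1..n}. Some \<one>\<^bsub>M\<^esub>) i) (\<lambda>x. Option.bind ((Some |` {1..n}) i)
          (\<lambda>j. map_option (\<lambda>y. x \<otimes>\<^bsub>M\<^esub> y) (a j)))) i = a i"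
        using cl[of i] undef[of i] by (cases "a i") auto
      show "(\<alpha> \<circ>\<^sub>m Some |` {1..n}) i = \<alpha> i"
        using dom by (auto simp: map_comp_def)
    qed
    show "p \<otimes>\<^bsub>wreath M n\<^esub> \<one>\<^bsub>wreath M n\<^esub> = p"
      unfolding p0 wreath_one wreath_mult
    proof (intro arg_cong2[where f = Pair] ext)
      fix i
      show "(\<lambda>i\<in>{1..n}. Option.bind (a i) (\<lambda>x. Option.bind (\<alpha> i)
          (\<lambda>j. map_option (\<lambda>y. x \<otimes>\<^bsub>M\<^esub> y) ((\<lambda>i\<in>{1..n}. Some \<one>\<^bsub>M\<^esub>) j)))) i = a i"
      proof (cases "i \<in> {1..n}")
        case True
        show ?thesis
        proof (cases "\<alpha> i")
          case None
          then show ?thesis using True ai[OF True] by simp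
        next
          case (Some j)
          then obtain x where "a i = Some x" using ai[OF True] by auto
          then show ?thesis using True Some range[of i] cl[of i] by auto
        qed
      qed (use undef in auto)
      show "(Some |` {1..n} \<circ>\<^sub>m \<alpha>) i = \<alpha> i"
        using range[of i] by (auto simp: map_comp_def split: option.splits)
    qed
  qed
qed


section \<open>Words as strand diagrams\<close>

text \<open>The pair consists of the word in the given alphabet that the strand starting at \<^term>\<open>i\<close>
  collects, and of its end point; the value \<^const>\<open>None\<close> says that the strand is cut. Letters act
  from left to right, in accordance with the composition of partial maps.\<close>

fun strand :: "'x letter list \<Rightarrow> nat \<Rightarrow> ('x list \<times> nat) option" where
  "strand [] i = Some ([], i)"
| "strand (SL k # w) i = strand w (transpose k (k + 1) i)"
| "strand (EL k # w) i = (if i = k then None else strand w i)"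
| "strand (XL x k # w) i =
     (if i = k then map_option (\<lambda>(u, j). (x # u, j)) (strand w i) else strand w i)"

lemma alphabet_simps [simp]:
  "SL i \<in> wreath_alphabet n X \<longleftrightarrow> i \<in> {1..<n}"
  "EL i \<in> wreath_alphabet n X \<longleftrightarrow> i \<in> {1..n}"
  "XL x i \<in> wreath_alphabet n X \<longleftrightarrow> x \<in> X \<and> i \<in> {1..n}"
  by (auto simp: wreath_alphabet_def)

lemma strand_in_range:
  "strand w i = Some (u, j) \<Longrightarrow> w \<in> lists (wreath_alphabet n X) \<Longrightarrow> i \<in> {1..n} \<Longrightarrow>
     u \<in> lists X \<and> j \<in> {1..n}"
proof (induction w i arbitrary: u rule: strand.induct)
  case (2 k w i)
  then have "transpose k (k + 1) i \<in> {1..n}" by (auto simp: transpose_def)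
  with 2 show ?case by simp
next
  case (3 k w i)
  then show ?case by (cases "i = k") simp_all
next
  case (4 x k w i)
  show ?case
  proof (cases "i = k")
    case True
    with "4.prems"(1) obtain u' where "strand w i = Some (u', j)" "u = x # u'" by auto
    with True 4 show ?thesis by simp
  qed (use 4 in simp)
qed simp

lemma word_at_in_lists:
  "u \<in> lists X \<Longrightarrow> i \<in> {1..n} \<Longrightarrow> word_at i u \<in> lists (wreath_alphabet n X)"
  by (induction u) (auto simp: word_at_def)

lemma strand_word_at:
  "strand (word_at k u) i = Some (if i = k then u else [], i)"
  by (induction u) (auto simp: word_at_def)

lemma wreath_relations_in_lists:
  assumes "R \<subseteq> lists X \<times> lists X"
  shows "wreath_relations n X R \<subseteq> lists (wreath_alphabet n X) \<times> lists (wreath_alphabet n X)"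
proof -
  have "u \<in> lists (wreath_alphabet n X) \<and> v \<in> lists (wreath_alphabet n X)"
    if "(u, v) \<in> wreath_relations n X R" for u v
    using that
  proof cases
    case (R9 u' v' i)
    moreover have "u' \<in> lists X" "v' \<in> lists X" using R9(3) assms by auto
    ultimately show ?thesis by (simp add: word_at_in_lists)
  qed auto
  then show ?thesis by auto
qed

lemma letter_image_in_carrier:
  assumes "monoid M" and "\<And>x. x \<in> X \<Longrightarrow> \<phi> [x] \<in> carrier M" and "l \<in> wreath_alphabet n X"
  shows "letter_image M n \<phi> l \<in> carrier (wreath M n)"
proof -
  interpret monoid M by fact
  show ?thesis
  proof (cases l)
    case (SL k)
    then have k: "k \<in> {1..<n}" using assms(3) by simp
    have range: "transpose k (k + 1) i \<in> {1..n}" if "i \<in> {1..n}" for i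
      using that k by (simp add: transpose_def)
    have "ran ((Some \<circ> transpose k (k + 1)) |` {1..n}) \<subseteq> {1..n}"
    proof
      fix j assume "j \<in> ran ((Some \<circ> transpose k (k + 1)) |` {1..n})"
      then obtain i where "i \<in> {1..n}" "transpose k (k + 1) i = j"
        unfolding ran_restrict_map_iff by blast
      then show "j \<in> {1..n}" using range by blast
    qed
    moreover have "inj_on ((Some \<circ> transpose k (k + 1)) |` {1..n}) {1..n}"
      by (rule inj_onI) (simp add: restrict_map_def, metis transpose_involutory)
    moreover have "dom (Some \<circ> transpose k (k + 1)) = UNIV"
      by auto
    ultimately show ?thesis
      by (simp add: SL carrier_wreath_iff)
  next
    case (EL k)
    have "{1..n} \<inter> ({1..n} - {k}) = {1..n} - {k}" by blast
    with EL show ?thesis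
      by (simp add: carrier_wreath_iff ran_partial_identity inj_on_partial_identity)
  next
    case (XL x k)
    then have "\<phi> [x] \<in> carrier M" using assms(3) by (intro assms(2)) simp
    with XL show ?thesis
      by (simp add: carrier_wreath_iff ran_partial_identity inj_on_partial_identity)
  qed
qed

text \<open>The recursion for strands is the product in the wreath product, read off for a letter on the
  left: the letter either moves, cuts or multiplies, and the rest of the word acts from the new position.\<close>

lemma wreath_map_eq_strand:
  assumes "monoid M" and hom: "\<phi> \<in> monoid_hom (free_monoid X) M"
    and "w \<in> lists (wreath_alphabet n X)"
  shows "wreath_map M n \<phi> w =
    ((\<lambda>i\<in>{1..n}. map_option (\<phi> \<circ> fst) (strand w i)),
     (\<lambda>i. if i \<in> {1..n} then map_option snd (strand w i) else None))"
  using assms(3)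
proof (induction w)
  case Nil
  then show ?case using hom
    by (auto simp: wreath_map_def free_extension_def wreath_def adjoin_zero_def
        sym_inv_monoid_def monoid_hom_def free_monoid_def)
next
  case (Cons l w)
  interpret monoid M by fact
  have \<phi>cl: "\<phi> u \<in> carrier M" if "u \<in> lists X" for u
    using hom that by (auto simp: monoid_hom_def hom_def free_monoid_def)
  have \<phi>cons: "\<phi> (x # u) = \<phi> [x] \<otimes>\<^bsub>M\<^esub> \<phi> u" if "x \<in> X" "u \<in> lists X" for x u
  proof -
    have "\<forall>u\<in>lists X. \<forall>v\<in>lists X. \<phi> (u @ v) = \<phi> u \<otimes>\<^bsub>M\<^esub> \<phi> v"
      using hom by (simp add: monoid_hom_def hom_def free_monoid_def)
    from this[rule_format, of "[x]" u] that show ?thesis by simp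
  qed
  have "w \<in> lists (wreath_alphabet n X)" using Cons.hyps by simp
  note range = strand_in_range[OF _ this]
  have strand_cl: "\<phi> u \<in> carrier M" if "strand w i = Some (u, j)" "i \<in> {1..n}" for i u j
    using range[OF that] \<phi>cl by blast
  have "wreath_map M n \<phi> (l # w) = letter_image M n \<phi> l \<otimes>\<^bsub>wreath M n\<^esub> wreath_map M n \<phi> w"
    by (simp add: wreath_map_def free_extension_def)
  also have "\<dots> = letter_image M n \<phi> l \<otimes>\<^bsub>wreath M n\<^esub>
    ((\<lambda>i\<in>{1..n}. map_option (\<phi> \<circ> fst) (strand w i)),
     (\<lambda>i. if i \<in> {1..n} then map_option snd (strand w i) else None))"
    by (simp only: Cons.IH)
  also have "\<dots> = ((\<lambda>i\<in>{1..n}. map_option (\<phi> \<circ> fst) (strand (l # w) i)),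
     (\<lambda>i. if i \<in> {1..n} then map_option snd (strand (l # w) i) else None))"
  proof -
    obtain b \<beta> where img: "letter_image M n \<phi> l = (b, \<beta>)" by fastforce
    have weights: "Option.bind (b i) (\<lambda>x. Option.bind (\<beta> i)
          (\<lambda>j. map_option (\<lambda>y. x \<otimes>\<^bsub>M\<^esub> y) ((\<lambda>i\<in>{1..n}. map_option (\<phi> \<circ> fst) (strand w i)) j))) =
        map_option (\<phi> \<circ> fst) (strand (l # w) i)" if i: "i \<in> {1..n}" for i
    proof (cases l)
      case (SL k)
      have t: "transpose k (k + 1) i \<in> {1..n}"
        using SL Cons.hyps i by (auto simp: transpose_def)
      have "b i = Some \<one>\<^bsub>M\<^esub>" "\<beta> i = Some (transpose k (k + 1) i)"
        using img SL i by auto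
      then show ?thesis
        using SL t strand_cl[OF _ t] by (cases "strand w (transpose k (k + 1) i)") auto
    next
      case (EL k)
      have "b i = (if i = k then None else Some \<one>\<^bsub>M\<^esub>)" "\<beta> i = (if i = k then None else Some i)"
        using img EL i by auto
      then show ?thesis
        using EL i strand_cl[OF _ i] by (cases "strand w i") auto
    next
      case (XL x k)
      have "b i = Some (if i = k then \<phi> [x] else \<one>\<^bsub>M\<^esub>)" "\<beta> i = Some i"
        using img XL i by auto
      moreover have "\<phi> (x # u) = \<phi> [x] \<otimes>\<^bsub>M\<^esub> \<phi> u" if "strand w i = Some (u, j)" for u j
        using \<phi>cons[of x u] XL Cons.hyps range[OF that i] by simp
      ultimately show ?thesis
        using XL i strand_cl[OF _ i] by (cases "strand w i") auto
    qed
    have maps: "((\<lambda>i. if i \<in> {1..n} then map_option snd (strand w i) else None) \<circ>\<^sub>m \<beta>) i =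
        (if i \<in> {1..n} then map_option snd (strand (l # w) i) else None)" for i
    proof (cases l)
      case (SL k)
      have t: "transpose k (k + 1) i \<in> {1..n}" if "i \<in> {1..n}"
        using SL Cons.hyps that by (auto simp: transpose_def)
      have "\<beta> i = (if i \<in> {1..n} then Some (transpose k (k + 1) i) else None)"
        using img SL by (auto simp: restrict_map_def)
      then show ?thesis
        using SL t by (auto simp: map_comp_def)
    next
      case (EL k)
      have "\<beta> i = (if i \<in> {1..n} - {k} then Some i else None)"
        using img EL by auto
      then show ?thesis
        using EL by (auto simp: map_comp_def)
    next
      case (XL x k)
      have "\<beta> i = (if i \<in> {1..n} then Some i else None)"
        using img XL by auto
      then show ?thesis
        using XL by (cases "strand w i") (auto simp: map_comp_def)
    qed
    show ?thesis
      unfolding img wreath_mult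
    proof (rule arg_cong2[where f = Pair])
      show "(\<lambda>i\<in>{1..n}. Option.bind (b i) (\<lambda>x. Option.bind (\<beta> i)
          (\<lambda>j. map_option (\<lambda>y. x \<otimes>\<^bsub>M\<^esub> y) ((\<lambda>i\<in>{1..n}. map_option (\<phi> \<circ> fst) (strand w i)) j)))) =
        (\<lambda>i\<in>{1..n}. map_option (\<phi> \<circ> fst) (strand (l # w) i))"
        by (rule restrict_ext) (rule weights)
    qed (rule ext, rule maps)
  qed
  finally show ?case .
qed

text \<open>The relations that are copied from the presentation of the monoid are the only ones that
  change what a strand collects; all the others preserve every strand literally.\<close>

lemma strand_relations:
  assumes "(u, v) \<in> wreath_relations n X R"
  shows "strand u i = strand v i \<or> (\<exists>u' v' k. (u', v') \<in> R \<and> u = word_at k u' \<and> v = word_at k v')"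
  using assms
proof cases
  case (R2 k l)
  then have "k \<noteq> l" "k + 1 \<noteq> l" "l + 1 \<noteq> k" by auto
  then have "transpose l (l + 1) (transpose k (k + 1) i) = transpose k (k + 1) (transpose l (l + 1) i)"
    by (simp add: transpose_def)
  then show ?thesis using R2 by simp
next
  case (R3 k l)
  then consider "l = Suc k" | "k = Suc l" by fastforce
  then have "transpose k (k + 1) (transpose l (l + 1) (transpose k (k + 1) i)) =
        transpose l (l + 1) (transpose k (k + 1) (transpose l (l + 1) i))"
    by cases (simp_all add: transpose_def)
  then show ?thesis using R3 by simp
next
  case (R9 u' v' k)
  then show ?thesis by blast
next
  case (R10 x y k l)
  then show ?thesis by (cases "i = k"; cases "i = l") simp_all
qed (simp_all add: transpose_def)


section \<open>Words in the transposition letters\<close>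

text \<open>The permutation of all natural numbers that a word describes; letters other than
  \<^term>\<open>SL k\<close> are ignored, so that composition needs no side conditions.\<close>

primrec perm :: "'x letter list \<Rightarrow> nat \<Rightarrow> nat" where
  "perm [] = id"
| "perm (l # w) = perm w \<circ> (case l of SL k \<Rightarrow> transpose k (k + 1) | _ \<Rightarrow> id)"

lemma perm_append: "perm (u @ v) = perm v \<circ> perm u"
  by (induction u) (simp_all add: comp_assoc)

lemma perm_permutes:
  assumes "\<sigma> \<in> lists (SL ` {1..<k})"
  shows "perm \<sigma> permutes {1..k}"
  using assms
proof (induction \<sigma>)
  case Nil
  show ?case by (simp only: perm.simps permutes_id)
next
  case (Cons l \<sigma>)
  then obtain i where l: "l = SL i" "i \<in> {1..<k}" by blast
  then have "transpose i (i + 1) permutes {1..k}" by (intro permutes_swap_id) simp_all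
  then show ?case
    unfolding perm.simps l(1) letter.case by (rule permutes_compose[OF _ Cons.IH])
qed

lemma perm_append_rev:
  assumes "\<sigma> \<in> lists (SL ` I)"
  shows "perm (\<sigma> @ rev \<sigma>) = id"
  using assms
proof (induction \<sigma>)
  case (Cons l \<sigma>)
  then obtain i where l: "l = SL i" by blast
  have "perm ((l # \<sigma>) @ rev (l # \<sigma>)) = transpose i (i + 1) \<circ> perm (\<sigma> @ rev \<sigma>) \<circ> transpose i (i + 1)"
    by (simp add: l perm_append comp_assoc)
  with Cons.IH show ?case by simp
qed simp

lemma strand_perm:
  assumes "\<sigma> \<in> lists (SL ` I)"
  shows "strand \<sigma> i = Some ([], perm \<sigma> i)"
  using assms
proof (induction \<sigma> arbitrary: i)
  case (Cons l \<sigma>)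
  then obtain k where "l = SL k" by blast
  then show ?case using Cons.IH by simp
qed simp

text \<open>The word \<^term>\<open>swap_word a d\<close> represents the transposition of \<^term>\<open>a\<close> and
  \<^term>\<open>a + d + 1\<close>, obtained from the adjacent transposition at \<^term>\<open>a\<close> by successive conjugation.\<close>

fun swap_word :: "nat \<Rightarrow> nat \<Rightarrow> 'x letter list" where
  "swap_word a 0 = [SL a]"
| "swap_word a (Suc d) = SL (a + d + 1) # swap_word a d @ [SL (a + d + 1)]"

lemma perm_swap_word: "perm (swap_word a d) = transpose a (a + d + 1)"
proof (induction d)
  case (Suc d)
  then show ?case
    by (simp add: perm_append) (simp add: fun_eq_iff transpose_def)
qed simp

lemma swap_word_in_lists:
  "1 \<le> a \<Longrightarrow> a + d + 1 \<le> k \<Longrightarrow> swap_word a d \<in> lists (SL ` {1..<k})"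
  by (induction d) simp_all

lemma transposition_word:
  assumes "a \<in> {1..k}" and "b \<in> {1..k}" and "a \<noteq> b"
  shows "\<exists>\<sigma> \<in> lists (SL ` {1..<k}). perm \<sigma> = transpose a b"
proof -
  have *: "\<exists>\<sigma> \<in> lists (SL ` {1..<k}). perm \<sigma> = transpose a b" if "1 \<le> a" "a < b" "b \<le> k" for a b
  proof
    have d: "a + (b - a - 1) + 1 = b" using that(2) by simp
    show "perm (swap_word a (b - a - 1)) = transpose a b"
      unfolding perm_swap_word d ..
    show "swap_word a (b - a - 1) \<in> lists (SL ` {1..<k})"
      using that d by (intro swap_word_in_lists) simp_all
  qed
  show ?thesis
  proof (cases "a < b")
    case True
    then show ?thesis using *[of a b] assms by simp
  next
    case False
    then show ?thesis using *[of b a] assms by (simp add: transpose_commute[of a b])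
  qed
qed

lemma permutation_word:
  assumes "\<pi> permutes {1..k}"
  shows "\<exists>\<sigma> \<in> lists (SL ` {1..<k} :: 'x letter set). perm \<sigma> = \<pi>"
  using assms finite_atLeastAtMost
proof (induction rule: permutes_induct)
  case id
  show ?case by (rule bexI[of _ "[]"]) simp_all
next
  case (swap a b p)
  obtain \<sigma> :: "'x letter list" where "\<sigma> \<in> lists (SL ` {1..<k})" "perm \<sigma> = p"
    using swap.IH by blast
  moreover obtain \<tau> :: "'x letter list" where "\<tau> \<in> lists (SL ` {1..<k})" "perm \<tau> = transpose a b"
    using transposition_word[OF swap.hyps(1-3)] by blast
  ultimately show ?case by (intro bexI[of _ "\<sigma> @ \<tau>"]) (simp_all add: perm_append)
qed

text \<open>The word with letters \<^term>\<open>SL k\<close>, ..., \<^term>\<open>SL j\<close> in descending order (empty for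
  \<^term>\<open>j = Suc k\<close>). These words are representatives of the cosets of the symmetric group on
  the first \<^term>\<open>k\<close> points in the one on the first \<^term>\<open>Suc k\<close> points: the coset is
  recognised by the point \<^term>\<open>j\<close> to which \<^term>\<open>Suc k\<close> is sent.\<close>

definition descent :: "nat \<Rightarrow> nat \<Rightarrow> 'x letter list" where
  "descent k j = map SL (rev [j..<Suc k])"

lemma descent_empty [simp]: "descent k (Suc k) = []"
  by (simp add: descent_def)

lemma descent_snoc: "j \<le> k \<Longrightarrow> descent k j = descent k (Suc j) @ [SL j]"
  by (simp add: descent_def upt_conv_Cons)

lemma descent_split:
  assumes "j \<le> Suc m" and "m \<le> k"
  shows "descent k j = descent k (Suc m) @ descent m j"
proof -
  have "[j..<Suc k] = [j..<Suc m] @ [Suc m..<Suc k]"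
    using assms upt_add_eq_append[of j "Suc m" "k - m"] by simp
  then show ?thesis by (simp only: descent_def rev_append map_append)
qed

lemma descent_in_lists: "1 \<le> j \<Longrightarrow> k < m \<Longrightarrow> descent k j \<in> lists (SL ` {1..<m})"
  by (auto simp: descent_def)

lemma perm_descent: "j \<le> Suc k \<Longrightarrow> perm (descent k j) (Suc k) = j"
proof (induction j rule: inc_induct)
  case (step j)
  then show ?case by (simp add: descent_snoc perm_append)
qed simp


section \<open>Diagonal words\<close>

fun position :: "'x letter \<Rightarrow> nat" where
  "position (SL i) = i"
| "position (EL i) = i"
| "position (XL x i) = i"

definition diagonal_alphabet :: "nat \<Rightarrow> 'x set \<Rightarrow> 'x letter set" where
  "diagonal_alphabet n X = wreath_alphabet n X - range SL"

lemma diagonal_simps [simp]: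
  "SL i \<notin> diagonal_alphabet n X"
  "EL i \<in> diagonal_alphabet n X \<longleftrightarrow> i \<in> {1..n}"
  "XL x i \<in> diagonal_alphabet n X \<longleftrightarrow> x \<in> X \<and> i \<in> {1..n}"
  by (simp_all add: diagonal_alphabet_def image_iff)

lemma diagonal_cases:
  assumes "l \<in> diagonal_alphabet n X"
  obtains (E) i where "l = EL i" "i \<in> {1..n}" | (X) x i where "l = XL x i" "x \<in> X" "i \<in> {1..n}"
  using assms by (cases l) simp_all

lemma diagonal_position: "l \<in> diagonal_alphabet n X \<Longrightarrow> position l \<in> {1..n}"
  by (cases l) simp_all

text \<open>On a diagonal word that does not cut position \<^term>\<open>i\<close>, this is the word that strand
  \<^term>\<open>i\<close> collects.\<close>

fun coordinate :: "nat \<Rightarrow> 'x letter list \<Rightarrow> 'x list" where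
  "coordinate i [] = []"
| "coordinate i (XL x k # w) = (if i = k then x # coordinate i w else coordinate i w)"
| "coordinate i (_ # w) = coordinate i w"

lemma coordinate_append: "coordinate i (u @ v) = coordinate i u @ coordinate i v"
  by (induction i u rule: coordinate.induct) simp_all

lemma coordinate_word_at: "coordinate i (word_at k u) = (if i = k then u else [])"
  by (cases "i = k"; induction u) (simp_all add: word_at_def)

lemma coordinate_in_lists: "p \<in> lists (diagonal_alphabet n X) \<Longrightarrow> coordinate i p \<in> lists X"
  by (induction i p rule: coordinate.induct) simp_all

lemma coordinate_filter_eq:
  "coordinate i (filter (\<lambda>l. position l = k) p) = (if i = k then coordinate i p else [])"
proof (induction p)
  case (Cons l p)
  then show ?case by (cases l) auto
qed simp

lemma coordinate_filter_neq:
  "coordinate i (filter (\<lambda>l. position l \<noteq> k) p) = (if i = k then [] else coordinate i p)"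
proof (induction p)
  case (Cons l p)
  then show ?case by (cases l) auto
qed simp

lemma coordinate_eq_Nil: "(\<forall>l\<in>set p. position l \<noteq> i) \<Longrightarrow> coordinate i p = []"
  by (induction i p rule: coordinate.induct) simp_all

lemma word_at_coordinate:
  assumes "p \<in> lists (diagonal_alphabet n X)" and "\<forall>l\<in>set p. position l = k" and "EL k \<notin> set p"
  shows "p = word_at k (coordinate k p)"
  using assms
proof (induction p)
  case (Cons l p)
  then obtain x where "l = XL x k" by (cases l) auto
  with Cons show ?case by (simp add: word_at_def)
qed (simp add: word_at_def)

lemma strand_diagonal_perm:
  assumes "p \<in> lists (diagonal_alphabet n X)" and "\<sigma> \<in> lists (SL ` I)"
  shows "strand (p @ \<sigma>) i = (if EL i \<in> set p then None else Some (coordinate i p, perm \<sigma> i))"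
  using assms(1)
proof (induction p)
  case Nil
  show ?case using strand_perm[OF assms(2)] by simp
next
  case (Cons l p)
  then show ?case by (cases l) auto
qed


section \<open>The congruence of the wreath relations\<close>

locale wreath_presentation =
  fixes M :: "('m, 'k) monoid_scheme"
    and X :: "'x set"
    and R :: "('x list \<times> 'x list) set"
    and \<phi> :: "'x list \<Rightarrow> 'm"
    and n :: nat
  assumes monoid: "monoid M"
    and presentation: "has_presentation M X R \<phi>"
begin

lemma
  shows relators: "R \<subseteq> lists X \<times> lists X"
    and \<phi>_hom: "\<phi> \<in> monoid_hom (free_monoid X) M"
    and \<phi>_surj: "\<phi> ` lists X = carrier M"
    and \<phi>_kernel: "monoid_kernel (free_monoid X) \<phi> = generated_congruence (free_monoid X) R"
  using presentation unfolding has_presentation_def by blast+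

abbreviation words :: "'x letter list set" where
  "words \<equiv> lists (wreath_alphabet n X)"

abbreviation diagonal :: "'x letter list set" where
  "diagonal \<equiv> lists (diagonal_alphabet n X)"

definition equivalent :: "'x letter list \<Rightarrow> 'x letter list \<Rightarrow> bool" (infix "\<simeq>" 50) where
  "u \<simeq> v \<longleftrightarrow> (u, v) \<in> generated_congruence (free_monoid (wreath_alphabet n X)) (wreath_relations n X R)"

lemma congruence:
  "monoid_congruence (free_monoid (wreath_alphabet n X))
     (generated_congruence (free_monoid (wreath_alphabet n X)) (wreath_relations n X R))"
  by (rule monoid_congruence_generated[OF monoid_free_monoid])
     (unfold carrier_free_monoid, rule wreath_relations_in_lists[OF relators])

lemma eqv_words:
  assumes "u \<simeq> v"
  shows "u \<in> words" and "v \<in> words"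
  using monoid_congruence_subset[OF congruence] assms
  by (auto simp: equivalent_def free_monoid_def)

lemma eqv_refl: "u \<in> words \<Longrightarrow> u \<simeq> u"
  using monoid_congruence_refl[OF congruence, of u] by (simp add: equivalent_def free_monoid_def)

lemma eqv_sym: "u \<simeq> v \<Longrightarrow> v \<simeq> u"
  unfolding equivalent_def by (rule monoid_congruence_sym[OF congruence])

lemma eqv_trans [trans]: "u \<simeq> v \<Longrightarrow> v \<simeq> w \<Longrightarrow> u \<simeq> w"
  unfolding equivalent_def by (rule monoid_congruence_trans[OF congruence])

lemma eqv_append: "u \<simeq> v \<Longrightarrow> u' \<simeq> v' \<Longrightarrow> u @ u' \<simeq> v @ v'"
  using monoid_congruence_mult[OF congruence, of u v u' v']
  by (simp add: equivalent_def free_monoid_def)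

lemma eqv_relation: "(u, v) \<in> wreath_relations n X R \<Longrightarrow> u \<simeq> v"
  unfolding equivalent_def by (rule subsetD[OF generated_congruence_base])

lemma eqv_in_context: "u \<simeq> v \<Longrightarrow> a \<in> words \<Longrightarrow> b \<in> words \<Longrightarrow> a @ u @ b \<simeq> a @ v @ b"
  by (intro eqv_append eqv_refl)

lemma eqv_append_left: "u \<simeq> v \<Longrightarrow> a \<in> words \<Longrightarrow> a @ u \<simeq> a @ v"
  by (intro eqv_append eqv_refl)

lemma eqv_append_right: "u \<simeq> v \<Longrightarrow> b \<in> words \<Longrightarrow> u @ b \<simeq> v @ b"
  by (intro eqv_append eqv_refl)

lemma diagonal_words: "p \<in> diagonal \<Longrightarrow> p \<in> words"
  by (auto simp: diagonal_alphabet_def)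

lemma SL_words: "\<sigma> \<in> lists (SL ` {1..<k}) \<Longrightarrow> k \<le> n \<Longrightarrow> \<sigma> \<in> words"
  by (auto simp: in_lists_conv_set)

lemma letter_commutes_with_word:
  assumes "a \<in> wreath_alphabet n X" and "w \<in> words" and "\<forall>b\<in>set w. [a, b] \<simeq> [b, a]"
  shows "a # w \<simeq> w @ [a]"
  using assms(2,3)
proof (induction w)
  case Nil
  show ?case using eqv_refl[of "[a]"] assms(1) by simp
next
  case (Cons b w)
  have "[a, b] @ w \<simeq> [b, a] @ w"
    using Cons.prems Cons.hyps by (intro eqv_append_right) simp_all
  also have "[b, a] @ w \<simeq> [b] @ (w @ [a])"
    using eqv_append_left[of "a # w" "w @ [a]" "[b]"] Cons by simp
  finally show ?case by simp
qed


section \<open>Soundness of the relations\<close>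

lemma wreath_map_hom: "wreath_map M n \<phi> \<in> monoid_hom (free_monoid (wreath_alphabet n X)) (wreath M n)"
proof -
  have "\<phi> [x] \<in> carrier M" if "x \<in> X" for x
    using \<phi>_surj that by auto
  then show ?thesis
    unfolding wreath_map_def
    by (intro free_extension_monoid_hom monoid_wreath letter_image_in_carrier monoid)
qed

lemma wreath_map_eq_iff:
  assumes "u \<in> words" and "v \<in> words"
  shows "wreath_map M n \<phi> u = wreath_map M n \<phi> v \<longleftrightarrow>
    (\<forall>i\<in>{1..n}. map_option (map_prod \<phi> id) (strand u i) = map_option (map_prod \<phi> id) (strand v i))"
proof -
  have option_eq: "map_option (map_prod \<phi> id) a = map_option (map_prod \<phi> id) b \<longleftrightarrow>
      map_option (\<phi> \<circ> fst) a = map_option (\<phi> \<circ> fst) b \<and> map_option snd a = map_option snd b"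
    for a b :: "('x list \<times> nat) option"
    by (cases a; cases b) (auto simp: map_prod_def split: prod.splits)
  note strand = wreath_map_eq_strand[OF monoid \<phi>_hom]
  show ?thesis
  proof
    assume eq: "wreath_map M n \<phi> u = wreath_map M n \<phi> v"
    show "\<forall>i\<in>{1..n}. map_option (map_prod \<phi> id) (strand u i) = map_option (map_prod \<phi> id) (strand v i)"
    proof
      fix i assume i: "i \<in> {1..n}"
      have "fst (wreath_map M n \<phi> u) i = fst (wreath_map M n \<phi> v) i"
        "snd (wreath_map M n \<phi> u) i = snd (wreath_map M n \<phi> v) i"
        using eq by simp_all
      then show "map_option (map_prod \<phi> id) (strand u i) = map_option (map_prod \<phi> id) (strand v i)"
        unfolding strand[OF assms(1)] strand[OF assms(2)] option_eq using i by simp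
    qed
  next
    assume "\<forall>i\<in>{1..n}. map_option (map_prod \<phi> id) (strand u i) = map_option (map_prod \<phi> id) (strand v i)"
    then show "wreath_map M n \<phi> u = wreath_map M n \<phi> v"
      unfolding strand[OF assms(1)] strand[OF assms(2)] option_eq
      by (simp add: fun_eq_iff restrict_def)
  qed
qed

lemma relation_sound:
  assumes "(u, v) \<in> wreath_relations n X R"
  shows "wreath_map M n \<phi> u = wreath_map M n \<phi> v"
proof -
  have "u \<in> words" "v \<in> words"
    using wreath_relations_in_lists[OF relators] assms by blast+
  moreover have "map_option (map_prod \<phi> id) (strand u i) = map_option (map_prod \<phi> id) (strand v i)" for i
    using strand_relations[OF assms, of i]
  proof (elim disjE exE conjE)
    fix u' v' k assume *: "(u', v') \<in> R" "u = word_at k u'" "v = word_at k v'"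
    then have "(u', v') \<in> monoid_kernel (free_monoid X) \<phi>"
      unfolding \<phi>_kernel using generated_congruence_base by blast
    then show ?thesis by (simp add: * strand_word_at monoid_kernel_def)
  qed simp
  ultimately show ?thesis by (simp add: wreath_map_eq_iff)
qed

lemma eqv_sound:
  assumes "u \<simeq> v"
  shows "wreath_map M n \<phi> u = wreath_map M n \<phi> v"
proof -
  have "wreath_relations n X R \<subseteq> monoid_kernel (free_monoid (wreath_alphabet n X)) (wreath_map M n \<phi>)"
    using wreath_relations_in_lists[OF relators] relation_sound
    by (force simp: monoid_kernel_def free_monoid_def)
  from generated_congruence_least[OF monoid_kernel_congruence[OF monoid_free_monoid wreath_map_hom] this]
  show ?thesis using assms by (auto simp: equivalent_def monoid_kernel_def)
qed

text \<open>By soundness, the relations cannot change the end points of the strands.\<close>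

lemma perm_cong:
  assumes "\<sigma> \<simeq> \<tau>" and "\<sigma> \<in> lists (SL ` {1..<n})" and "\<tau> \<in> lists (SL ` {1..<n})"
  shows "perm \<sigma> = perm \<tau>"
proof
  fix i
  show "perm \<sigma> i = perm \<tau> i"
  proof (cases "i \<in> {1..n}")
    case True
    then show ?thesis
      using eqv_sound[OF assms(1)] wreath_map_eq_iff[OF eqv_words[OF assms(1)]]
        strand_perm[OF assms(2)] strand_perm[OF assms(3)] by simp
  next
    case False
    then show ?thesis
      using permutes_not_in[OF perm_permutes] assms(2,3) by metis
  qed
qed


section \<open>The symmetric group relations\<close>

lemma cancel_rev:
  assumes "\<sigma> \<in> lists (SL ` {1..<n})"
  shows "\<sigma> @ rev \<sigma> \<simeq> []"
  using assms
proof (induction \<sigma>)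
  case Nil
  show ?case using eqv_refl[of "[]"] by simp
next
  case (Cons l \<sigma>)
  then obtain i where l: "l = SL i" "i \<in> {1..<n}" by blast
  have "[l] @ (\<sigma> @ rev \<sigma>) @ [l] \<simeq> [l] @ [] @ [l]"
    using Cons.IH l by (intro eqv_in_context) simp_all
  also have "[l] @ [] @ [l] \<simeq> []"
    using eqv_relation[OF R1[OF l(2)]] l(1) by simp
  finally show ?case by simp
qed

lemma descent_commute:
  assumes "1 \<le> j" and "k < n" and "i \<in> {1..<n}" and "i + 1 < j \<or> k + 1 < i"
  shows "descent k j @ [SL i] \<simeq> [SL i] @ descent k j"
proof -
  have "SL i # descent k j \<simeq> descent k j @ [SL i]"
  proof (rule letter_commutes_with_word)
    show "SL i \<in> wreath_alphabet n X" using assms(3) by simp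
    show "descent k j \<in> words" using assms(1,2) by (intro SL_words[of _ n] descent_in_lists) simp_all
    show "\<forall>b\<in>set (descent k j :: 'x letter list). [SL i, b] \<simeq> [b, SL i]"
    proof
      fix b :: "'x letter" assume "b \<in> set (descent k j)"
      then obtain m where m: "b = SL m" "j \<le> m" "m \<le> k" by (auto simp: descent_def)
      then have "\<bar>int i - int m\<bar> > 1" using assms(4) by linarith
      then show "[SL i, b] \<simeq> [b, SL i]"
        unfolding m(1) using m assms by (intro eqv_relation R2) simp_all
    qed
  qed
  from eqv_sym[OF this] show ?thesis by simp
qed

text \<open>A generator on the right of a coset representative either changes the representative or can
  be moved to the left of it, where it becomes a generator of the smaller symmetric group. The last
  case \<^term>\<open>j < i\<close> is the one that uses the braid relation.\<close>

lemma descent_mult: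
  assumes "k < n" and "j \<in> {1..Suc k}" and "i \<in> {1..k}"
  shows "\<exists>u \<in> lists (SL ` {1..<k}). \<exists>j' \<in> {1..Suc k}. descent k j @ [SL i] \<simeq> u @ descent k j'"
proof -
  have D: "descent m j \<in> words" if "1 \<le> j" "m \<le> k" for m j
    using that assms(1) by (intro SL_words[of _ n] descent_in_lists) simp_all
  have S: "SL i \<in> wreath_alphabet n X" using assms by simp
  consider "i + 1 < j" | "j = i + 1" | "i = j" | "j < i" by linarith
  then show ?thesis
  proof cases
    case 1
    then have "descent k j @ [SL i] \<simeq> [SL i] @ descent k j"
      using assms by (intro descent_commute) simp_all
    moreover have "[SL i] \<in> lists (SL ` {1..<k})" using 1 assms by simp
    ultimately show ?thesis using assms(2) by blast
  next
    case 2
    have "descent k j @ [SL i] \<simeq> [] @ descent k i"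
      using assms D[of i k] by (simp add: 2 eqv_refl flip: descent_snoc)
    moreover have "i \<in> {1..Suc k}" using assms by simp
    ultimately show ?thesis by blast
  next
    case 3
    have "descent k (Suc j) @ [SL i, SL i] \<simeq> descent k (Suc j) @ []"
      using assms 3 by (intro eqv_append_left eqv_relation R1 D) simp_all
    then have "descent k j @ [SL i] \<simeq> [] @ descent k (Suc j)"
      using 3 assms by (simp add: descent_snoc)
    moreover have "Suc j \<in> {1..Suc k}" using 3 assms by simp
    ultimately show ?thesis by blast
  next
    case 4
    \<comment> \<open>With \<open>h = i - 1\<close>, the representative has the form \<open>A s\<^sub>i s\<^sub>h B\<close>. The letter \<open>s\<^sub>i\<close> on
      the right commutes with \<open>B\<close>, the braid relation turns \<open>s\<^sub>i s\<^sub>h s\<^sub>i\<close> into \<open>s\<^sub>h s\<^sub>i s\<^sub>h\<close>, and the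
      leading \<open>s\<^sub>h\<close> commutes with \<open>A\<close>.\<close>
    define h where "h = i - 1"
    have i: "i = Suc h" using assms by (simp add: h_def)
    define A B :: "'x letter list" where "A = descent k (Suc i)" and "B = descent (h - 1) j"
    have split: "descent k j = A @ [SL i, SL h] @ B"
    proof -
      have "descent k j = A @ descent i j"
        unfolding A_def using 4 assms by (intro descent_split) simp_all
      also have "descent i j = ([SL i] @ descent h j :: 'x letter list)"
      proof -
        have "descent i j = (descent i (Suc h) @ descent h j :: 'x letter list)"
          using 4 i by (intro descent_split) simp_all
        also have "descent i (Suc h) = ([SL i] :: 'x letter list)"
          by (simp add: i descent_snoc)
        finally show ?thesis .
      qed
      also have "descent h j = [SL h] @ B"
      proof -
        have "descent h j = (descent h (Suc (h - 1)) @ descent (h - 1) j :: 'x letter list)"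
          using 4 i assms(2) by (intro descent_split) simp_all
        also have "descent h (Suc (h - 1)) = ([SL h] :: 'x letter list)"
          using 4 i assms(2) by (simp add: descent_snoc)
        finally show ?thesis by (simp only: B_def)
      qed
      finally show ?thesis by simp
    qed
    have h: "1 \<le> h" "h < k" "i < n" using 4 assms i by simp_all
    have Aw: "A \<in> words" unfolding A_def using D[of "Suc i" k] by simp
    have Bw: "B \<in> words" unfolding B_def using D[of j "h - 1"] assms(2) h by simp
    have BC: "B @ [SL i] \<simeq> [SL i] @ B"
      unfolding B_def using h assms(2) i by (intro descent_commute) simp_all
    have "descent k j @ [SL i] = (A @ [SL i, SL h]) @ (B @ [SL i])"
      by (simp add: split)
    also have "\<dots> \<simeq> (A @ [SL i, SL h]) @ ([SL i] @ B)"
      using BC Aw h i by (intro eqv_append_left) simp_all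
    also have "\<dots> = A @ [SL i, SL h, SL i] @ B" by simp
    also have "\<dots> \<simeq> A @ [SL h, SL i, SL h] @ B"
      using Aw Bw h i by (intro eqv_in_context eqv_relation R3) simp_all
    also have "\<dots> = (A @ [SL h]) @ ([SL i, SL h] @ B)" by simp
    also have "\<dots> \<simeq> ([SL h] @ A) @ ([SL i, SL h] @ B)"
    proof (rule eqv_append_right)
      show "A @ [SL h] \<simeq> [SL h] @ A"
        unfolding A_def using h i assms(1) by (intro descent_commute) simp_all
      show "[SL i, SL h] @ B \<in> words" using Bw h i by simp
    qed
    also have "\<dots> = [SL h] @ descent k j" by (simp add: split)
    finally show ?thesis
      using h assms(2) by (intro bexI[of _ "[SL h]"] bexI[of _ j]) simp_all
  qed
qed

lemma coset_decomposition:
  assumes "k < n" and "\<sigma> \<in> lists (SL ` {1..<Suc k})"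
  shows "\<exists>u \<in> lists (SL ` {1..<k}). \<exists>j \<in> {1..Suc k}. \<sigma> \<simeq> u @ descent k j"
  using assms(2)
proof (induction \<sigma> rule: rev_induct)
  case Nil
  have "[] \<simeq> [] @ descent k (Suc k)" by (simp add: eqv_refl)
  then show ?case by (intro bexI[of _ "[]"] bexI[of _ "Suc k"]) simp_all
next
  case (snoc l \<sigma>)
  then obtain i where l: "l = SL i" "i \<in> {1..k}" by auto
  have "\<sigma> \<in> lists (SL ` {1..<Suc k})" using snoc.prems by simp
  from snoc.IH[OF this] obtain u j where u: "u \<in> lists (SL ` {1..<k})" "j \<in> {1..Suc k}"
    "\<sigma> \<simeq> u @ descent k j" by blast
  from descent_mult[OF assms(1) u(2) l(2)] obtain v j' where v: "v \<in> lists (SL ` {1..<k})"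
    "j' \<in> {1..Suc k}" "descent k j @ [SL i] \<simeq> v @ descent k j'" by blast
  have "\<sigma> @ [l] \<simeq> (u @ descent k j) @ [l]"
    using u(3) l assms(1) by (intro eqv_append_right) simp_all
  also have "\<dots> = u @ (descent k j @ [SL i])" by (simp add: l)
  also have "\<dots> \<simeq> u @ (v @ descent k j')"
    using v(3) SL_words[OF u(1)] assms(1) by (intro eqv_append_left) simp_all
  also have "\<dots> = (u @ v) @ descent k j'" by simp
  finally have "\<sigma> @ [l] \<simeq> (u @ v) @ descent k j'" .
  moreover have "u @ v \<in> lists (SL ` {1..<k})" using u v by simp
  ultimately show ?case using v(2) by blast
qed

text \<open>Induction along the chain of symmetric groups. A word is equivalent to \<open>u @ descent k j\<close>
  with \<open>u\<close> over the smaller set of generators. As \<open>u\<close> fixes \<^term>\<open>Suc k\<close>, which the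
  representative sends to \<^term>\<open>j\<close>, an identity permutation forces
  \<^term>\<open>j = Suc k\<close>, so the representative is empty and \<open>u\<close> again represents the identity.\<close>

lemma identity_word:
  assumes "\<sigma> \<in> lists (SL ` {1..<k})" and "k \<le> n" and "perm \<sigma> = id"
  shows "\<sigma> \<simeq> []"
  using assms
proof (induction k arbitrary: \<sigma>)
  case 0
  then have "\<sigma> = []" by (cases \<sigma>) auto
  then show ?case by (simp add: eqv_refl)
next
  case (Suc k)
  then have k: "k < n" by simp
  from coset_decomposition[OF k Suc.prems(1)] obtain u j where
    u: "u \<in> lists (SL ` {1..<k})" "j \<in> {1..Suc k}" "\<sigma> \<simeq> u @ descent k j" by blast
  have mono: "lists (SL ` {1..<m}) \<subseteq> lists (SL ` {1..<n})" if "m \<le> n" for m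
    using that by (intro lists_mono image_mono) auto
  have "perm (u @ descent k j) = perm \<sigma>"
  proof (rule perm_cong[OF eqv_sym[OF u(3)]])
    show "\<sigma> \<in> lists (SL ` {1..<n})" using Suc.prems mono by blast
    have "descent k j \<in> lists (SL ` {1..<n})"
      using u(2) k by (intro descent_in_lists) simp_all
    moreover have "u \<in> lists (SL ` {1..<n})" using u(1) mono[of k] k by auto
    ultimately show "u @ descent k j \<in> lists (SL ` {1..<n})" by simp
  qed
  then have id: "perm (descent k j :: 'x letter list) \<circ> perm u = id" using Suc.prems(3) by (simp only: perm_append)
  have "perm u (Suc k) = Suc k"
    by (rule permutes_not_in[OF perm_permutes[OF u(1)]]) simp
  then have "perm (descent k j :: 'x letter list) (Suc k) = Suc k" using fun_cong[OF id, of "Suc k"] by simp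
  moreover have "perm (descent k j :: 'x letter list) (Suc k) = j"
    using u(2) by (intro perm_descent) simp
  ultimately have j: "j = Suc k" by simp
  then have "perm u = id" using id by simp
  with Suc.IH[OF u(1)] k have "u \<simeq> []" by simp
  with u(3) j show ?case using eqv_trans by simp
qed


section \<open>Normalising diagonal words\<close>

text \<open>The pairs of words whose copies at position \<^term>\<open>i\<close> are equivalent form a congruence that contains
  the given relations, hence it contains the kernel of the given presentation.\<close>

lemma word_at_cong:
  assumes "u \<in> lists X" and "v \<in> lists X" and "\<phi> u = \<phi> v" and i: "i \<in> {1..n}"
  shows "word_at i u \<simeq> word_at i v"
proof -
  have word: "word_at i u \<in> words" if "u \<in> lists X" for u
    by (rule word_at_in_lists[OF that i])
  have word_append: "word_at i (u @ v) = word_at i u @ word_at i v" for u v :: "'x list"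
    by (simp add: word_at_def)
  let ?E = "{(u, v). u \<in> lists X \<and> v \<in> lists X \<and> word_at i u \<simeq> word_at i v}"
  have "monoid_congruence (free_monoid X) ?E"
    unfolding monoid_congruence_def carrier_free_monoid
  proof (intro conjI equivI allI impI)
    show "refl_on (lists X) ?E" by (rule refl_onI) (simp add: eqv_refl word)
    show "sym ?E" by (rule symI) (simp add: eqv_sym)
    show "trans ?E" by (rule transI) (auto intro: eqv_trans)
    show "(a \<otimes>\<^bsub>free_monoid X\<^esub> c, b \<otimes>\<^bsub>free_monoid X\<^esub> d) \<in> ?E" if "(a, b) \<in> ?E" "(c, d) \<in> ?E" for a b c d
      using that by (simp add: free_monoid_def word_append eqv_append)
  qed auto
  moreover have "R \<subseteq> ?E"
    using relators eqv_relation[OF R9[OF _ i]] by auto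
  ultimately have "generated_congruence (free_monoid X) R \<subseteq> ?E"
    by (rule generated_congruence_least)
  moreover have "(u, v) \<in> generated_congruence (free_monoid X) R"
    using assms(1-3) by (simp add: monoid_kernel_def carrier_free_monoid flip: \<phi>_kernel)
  ultimately show ?thesis by blast
qed

lemma diagonal_commute:
  assumes "a \<in> diagonal_alphabet n X" and "b \<in> diagonal_alphabet n X" and "position a \<noteq> position b"
  shows "[a, b] \<simeq> [b, a]"
  using assms(1)
proof (cases a rule: diagonal_cases)
  case a: (E i)
  show ?thesis using assms(2)
  proof (cases b rule: diagonal_cases)
    case (E j)
    show ?thesis unfolding a E by (intro eqv_relation R5 a E)
  next
    case (X x j)
    then have "i \<noteq> j" using assms(3) a by simp
    then show ?thesis unfolding a X by (intro eqv_relation R13 a X)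
  qed
next
  case a: (X x i)
  show ?thesis using assms(2)
  proof (cases b rule: diagonal_cases)
    case (E j)
    then have "j \<noteq> i" using assms(3) a by simp
    then show ?thesis unfolding a E by (intro eqv_sym[OF eqv_relation] R13 a E)
  next
    case (X y j)
    then have "i \<noteq> j" using assms(3) a by simp
    then show ?thesis unfolding a X by (intro eqv_relation R10 a X)
  qed
qed

lemma EL_absorbs_letter:
  assumes "l \<in> diagonal_alphabet n X" and "position l = i"
  shows "[EL i, l] \<simeq> [EL i]" and "[l, EL i] \<simeq> [EL i]"
proof -
  have "[EL i, l] \<simeq> [EL i] \<and> [l, EL i] \<simeq> [EL i]"
    using assms(1)
  proof (cases l rule: diagonal_cases)
    case (E j)
    then show ?thesis using assms(2) eqv_relation[OF R4] by simp
  next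
    case (X x j)
    then show ?thesis using assms(2) eqv_relation[OF R14_left] eqv_sym[OF eqv_relation[OF R14_right]] by simp
  qed
  then show "[EL i, l] \<simeq> [EL i]" "[l, EL i] \<simeq> [EL i]" by simp_all
qed

text \<open>A cut commutes with letters at other positions by the relations, and with letters at its own
  position because it absorbs them from both sides.\<close>

lemma EL_commutes:
  assumes "p \<in> diagonal" and "i \<in> {1..n}"
  shows "[EL i] @ p \<simeq> p @ [EL i]"
proof -
  have "[EL i, l] \<simeq> [l, EL i]" if "l \<in> diagonal_alphabet n X" for l
  proof (cases "position l = i")
    case True
    then show ?thesis using EL_absorbs_letter[OF that] eqv_trans eqv_sym by blast
  next
    case False
    then show ?thesis using assms(2) that by (intro diagonal_commute) simp_all
  qed
  then have "\<forall>l\<in>set p. [EL i, l] \<simeq> [l, EL i]" using assms(1) by auto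
  then show ?thesis
    using letter_commutes_with_word[of "EL i" p] diagonal_words[OF assms(1)] assms(2) by simp
qed

lemma EL_absorbed:
  assumes "p \<in> diagonal" and "EL i \<in> set p"
  shows "p @ [EL i] \<simeq> p"
proof -
  obtain q r where p: "p = q @ [EL i] @ r" using split_list[OF assms(2)] by auto
  then have qr: "q \<in> diagonal" "r \<in> diagonal" "i \<in> {1..n}" using assms(1) by auto
  have "p @ [EL i] = (q @ [EL i]) @ (r @ [EL i])" by (simp add: p)
  also have "\<dots> \<simeq> (q @ [EL i]) @ ([EL i] @ r)"
    using qr by (intro eqv_append_left eqv_sym[OF EL_commutes]) (simp_all add: diagonal_words)
  also have "\<dots> = q @ [EL i, EL i] @ r" by simp
  also have "\<dots> \<simeq> q @ [EL i] @ r"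
    using qr by (intro eqv_in_context eqv_relation R4) (simp_all add: diagonal_words)
  finally show ?thesis by (simp only: p)
qed

lemma EL_absorbs:
  assumes "p \<in> diagonal" and "i \<in> {1..n}" and "\<forall>l\<in>set p. position l = i"
  shows "[EL i] @ p \<simeq> [EL i]"
  using assms(1,3)
proof (induction p)
  case Nil
  show ?case using assms(2) by (simp add: eqv_refl)
next
  case (Cons l p)
  have "[EL i, l] @ p \<simeq> [EL i] @ p"
    using Cons by (intro eqv_append_right EL_absorbs_letter) (simp_all add: diagonal_words)
  also have "[EL i] @ p \<simeq> [EL i]" using Cons by simp
  finally show ?case by simp
qed

lemma EL_collapse:
  assumes "p \<in> diagonal" and "EL i \<in> set p" and "\<forall>l\<in>set p. position l = i"
  shows "p \<simeq> [EL i]"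
proof -
  have i: "i \<in> {1..n}" using assms(1,2) by auto
  have "p \<simeq> p @ [EL i]" using EL_absorbed[OF assms(1,2)] by (rule eqv_sym)
  also have "p @ [EL i] \<simeq> [EL i] @ p" using EL_commutes[OF assms(1) i] by (rule eqv_sym)
  also have "[EL i] @ p \<simeq> [EL i]" using EL_absorbs[OF assms(1) i assms(3)] .
  finally show ?thesis .
qed

lemma collect_position:
  assumes "p \<in> diagonal"
  shows "p \<simeq> filter (\<lambda>l. position l = k) p @ filter (\<lambda>l. position l \<noteq> k) p"
  using assms
proof (induction p)
  case Nil
  show ?case by (simp add: eqv_refl)
next
  case (Cons l p)
  let ?F = "filter (\<lambda>l. position l = k) p" and ?G = "filter (\<lambda>l. position l \<noteq> k) p"
  have p: "p \<in> diagonal" and l: "l \<in> diagonal_alphabet n X" using Cons by simp_all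
  then have F: "?F \<in> diagonal" and G: "?G \<in> diagonal" by auto
  have lw: "[l] \<in> words" using l by (intro diagonal_words) simp
  have "[l] @ p \<simeq> [l] @ (?F @ ?G)"
    using Cons.IH lw by (intro eqv_append_left)
  also have "\<dots> \<simeq> filter (\<lambda>l. position l = k) (l # p) @ filter (\<lambda>l. position l \<noteq> k) (l # p)"
  proof (cases "position l = k")
    case True
    then show ?thesis using lw F G by (simp add: eqv_refl diagonal_words)
  next
    case False
    have "l # ?F \<simeq> ?F @ [l]"
    proof (rule letter_commutes_with_word)
      show "\<forall>b\<in>set ?F. [l, b] \<simeq> [b, l]"
        using False l p by (auto intro!: diagonal_commute)
    qed (use lw F in \<open>simp_all add: diagonal_words\<close>)
    then have "(l # ?F) @ ?G \<simeq> (?F @ [l]) @ ?G"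
      using G by (intro eqv_append_right diagonal_words)
    with False show ?thesis by simp
  qed
  finally show ?case by simp
qed

text \<open>Induction on a bound for the positions: the letters at the largest position are collected in
  front, where they form either a cut or a copy of a word with prescribed value, and the
  remaining letters satisfy the same hypotheses with a smaller bound.\<close>

lemma diagonal_eqv:
  assumes "p \<in> diagonal" and "q \<in> diagonal"
    and "\<forall>l \<in> set p \<union> set q. position l \<le> m"
    and "\<forall>i\<in>{1..n}. (EL i \<in> set p \<longleftrightarrow> EL i \<in> set q) \<and>
      (EL i \<notin> set p \<longrightarrow> \<phi> (coordinate i p) = \<phi> (coordinate i q))"
  shows "p \<simeq> q"
  using assms
proof (induction m arbitrary: p q)
  case 0
  have "set p \<union> set q = {}"
  proof (rule equals0I)
    fix l assume l: "l \<in> set p \<union> set q"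
    then have "position l \<in> {1..n}" using 0(1,2) by (intro diagonal_position) auto
    with 0(3) l show False by fastforce
  qed
  then show ?case by (simp add: eqv_refl)
next
  case (Suc m)
  let ?F = "filter (\<lambda>l. position l = Suc m)" and ?G = "filter (\<lambda>l. position l \<noteq> Suc m)"
  have F: "?F p \<in> diagonal" "?F q \<in> diagonal" and G: "?G p \<in> diagonal" "?G q \<in> diagonal"
    using Suc.prems(1,2) by auto
  have "?F p \<simeq> ?F q"
  proof (cases "Suc m \<in> {1..n}")
    case True
    show ?thesis
    proof (cases "EL (Suc m) \<in> set p")
      case True
      then have "EL (Suc m) \<in> set q" using Suc.prems(4) \<open>Suc m \<in> {1..n}\<close> by blast
      then have "?F q \<simeq> [EL (Suc m)]" using F by (intro EL_collapse) simp_all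
      moreover have "?F p \<simeq> [EL (Suc m)]" using True F by (intro EL_collapse) simp_all
      ultimately show ?thesis using eqv_sym eqv_trans by blast
    next
      case False
      then have q: "EL (Suc m) \<notin> set q" using Suc.prems(4) \<open>Suc m \<in> {1..n}\<close> by blast
      have "?F p = word_at (Suc m) (coordinate (Suc m) (?F p))"
        using F(1) False by (intro word_at_coordinate) simp_all
      moreover have "?F q = word_at (Suc m) (coordinate (Suc m) (?F q))"
        using F(2) q by (intro word_at_coordinate) simp_all
      moreover have "word_at (Suc m) (coordinate (Suc m) p) \<simeq> word_at (Suc m) (coordinate (Suc m) q)"
        using Suc.prems False \<open>Suc m \<in> {1..n}\<close> by (intro word_at_cong coordinate_in_lists) blast+
      ultimately show ?thesis by (simp only: coordinate_filter_eq if_True simp_thms)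
    qed
  next
    case False
    then have "?F p = []" "?F q = []"
      using Suc.prems(1,2) diagonal_position[of _ n X] unfolding filter_empty_conv by (metis in_listsD)+
    then show ?thesis by (simp add: eqv_refl)
  qed
  moreover have "?G p \<simeq> ?G q"
  proof (rule Suc.IH[OF G])
    show "\<forall>l\<in>set (?G p) \<union> set (?G q). position l \<le> m"
      using Suc.prems(3) by (auto simp: le_Suc_eq)
    show "\<forall>i\<in>{1..n}. (EL i \<in> set (?G p) \<longleftrightarrow> EL i \<in> set (?G q)) \<and>
        (EL i \<notin> set (?G p) \<longrightarrow> \<phi> (coordinate i (?G p)) = \<phi> (coordinate i (?G q)))"
      using Suc.prems(4) by (simp add: coordinate_filter_neq)
  qed
  ultimately have "?F p @ ?G p \<simeq> ?F q @ ?G q" by (rule eqv_append)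
  from eqv_trans[OF collect_position[OF Suc.prems(1)] this]
  show ?case using eqv_sym[OF collect_position[OF Suc.prems(2)]] by (rule eqv_trans)
qed


section \<open>Permutations absorbed by diagonal words\<close>

text \<open>Induction on the distance of the two cuts. Moving the outer letter of \<^const>\<open>swap_word\<close>
  to the left across the cuts brings them one step closer; after the inner word is absorbed, the letter is
  moved back and cancels against its copy at the other end.\<close>

lemma pair_absorbs_swap_word:
  assumes "1 \<le> a" and "a + d + 1 \<le> n"
  shows "[EL a, EL (a + d + 1)] @ swap_word a d \<simeq> [EL a, EL (a + d + 1)]"
  using assms
proof (induction d)
  case 0
  then show ?case using eqv_relation[OF R8[of a n]] by simp
next
  case (Suc d)
  define b where "b = a + d + 1"
  have b: "a < b" "b < n" "1 \<le> a" using Suc.prems by (simp_all add: b_def)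
  have T: "swap_word a d \<in> words"
    using Suc.prems by (intro SL_words[of _ n] swap_word_in_lists) simp_all
  have slide: "[EL a, EL (b + 1)] @ [SL b] \<simeq> [SL b] @ [EL a, EL b]"
  proof -
    have "[EL a] @ [EL (b + 1), SL b] \<simeq> [EL a] @ [SL b, EL b]"
      using b by (intro eqv_append_left eqv_sym[OF eqv_relation] R7) simp_all
    also have "\<dots> = [EL a, SL b] @ [EL b]" by simp
    also have "\<dots> \<simeq> [SL b, EL a] @ [EL b]"
      using b by (intro eqv_append_right eqv_sym[OF eqv_relation] R6) simp_all
    finally show ?thesis by simp
  qed
  have "[EL a, EL (a + Suc d + 1)] @ swap_word a (Suc d) =
      ([EL a, EL (b + 1)] @ [SL b]) @ (swap_word a d @ [SL b])"
    by (simp add: b_def)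
  also have "\<dots> \<simeq> ([SL b] @ [EL a, EL b]) @ (swap_word a d @ [SL b])"
    using slide T b by (intro eqv_append_right) simp_all
  also have "\<dots> = [SL b] @ ([EL a, EL b] @ swap_word a d) @ [SL b]" by simp
  also have "\<dots> \<simeq> [SL b] @ [EL a, EL b] @ [SL b]"
    using Suc b by (intro eqv_in_context) (simp_all add: b_def)
  also have "\<dots> = ([SL b] @ [EL a, EL b]) @ [SL b]" by simp
  also have "\<dots> \<simeq> ([EL a, EL (b + 1)] @ [SL b]) @ [SL b]"
    using slide b by (intro eqv_append_right eqv_sym[OF slide]) simp_all
  also have "\<dots> = [EL a, EL (b + 1)] @ [SL b, SL b]" by simp
  also have "\<dots> \<simeq> [EL a, EL (b + 1)] @ []"
    using b by (intro eqv_append_left eqv_relation R1) simp_all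
  finally show ?case by (simp add: b_def)
qed

lemma absorbs_transposition:
  assumes "p \<in> diagonal" and "EL a \<in> set p" and "EL b \<in> set p" and "a \<noteq> b"
  shows "\<exists>\<tau> \<in> lists (SL ` {1..<n}). perm \<tau> = transpose a b \<and> p @ \<tau> \<simeq> p"
proof -
  have *: "\<exists>\<tau> \<in> lists (SL ` {1..<n}). perm \<tau> = transpose a b \<and> p @ \<tau> \<simeq> p"
    if "EL a \<in> set p" "EL b \<in> set p" "a < b" for a b
  proof -
    have ab: "a \<in> {1..n}" "b \<in> {1..n}" using assms(1) that by auto
    define d where "d = b - a - 1"
    have d: "b = a + d + 1" using that(3) by (simp add: d_def)
    have p: "p \<in> words" using assms(1) by (rule diagonal_words)
    have \<tau>: "swap_word a d \<in> lists (SL ` {1..<n})"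
      using ab d by (intro swap_word_in_lists) simp_all
    then have \<tau>w: "swap_word a d \<in> words" by (rule SL_words) simp
    have pab: "p @ [EL a, EL b] \<simeq> p"
    proof -
      have "(p @ [EL a]) @ [EL b] \<simeq> p @ [EL b]"
        using EL_absorbed[OF assms(1) that(1)] ab by (intro eqv_append_right) simp_all
      also have "p @ [EL b] \<simeq> p" by (rule EL_absorbed[OF assms(1) that(2)])
      finally show ?thesis by simp
    qed
    have "p @ swap_word a d \<simeq> (p @ [EL a, EL b]) @ swap_word a d"
      using pab \<tau>w by (intro eqv_append_right eqv_sym[OF pab])
    also have "\<dots> = p @ ([EL a, EL (a + d + 1)] @ swap_word a d)" by (simp add: d)
    also have "\<dots> \<simeq> p @ [EL a, EL (a + d + 1)]"
      using ab d p by (intro eqv_append_left pair_absorbs_swap_word) simp_all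
    also have "\<dots> = p @ [EL a, EL b]" by (simp add: d)
    also note pab
    finally have "p @ swap_word a d \<simeq> p" .
    moreover have "perm (swap_word a d :: 'x letter list) = transpose a b"
      by (simp add: perm_swap_word d)
    ultimately show ?thesis using \<tau> by blast
  qed
  show ?thesis
  proof (cases "a < b")
    case True
    then show ?thesis using *[OF assms(2,3)] by simp
  next
    case False
    then show ?thesis using *[OF assms(3,2)] assms(4) by (simp add: transpose_commute[of a b])
  qed
qed

text \<open>A permutation of the cut positions is a product of transpositions of such positions. As \<^term>\<open>p\<close>
  absorbs each of them, a word for one can be inserted in front of \<^term>\<open>\<sigma>\<close>, where it cancels a
  factor of the permutation. What remains at the end is a word for the identity.\<close>

lemma absorbs_permutation:
  assumes "p \<in> diagonal" and "\<pi> permutes {i. EL i \<in> set p}"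
    and "\<sigma> \<in> lists (SL ` {1..<n})" and "perm \<sigma> = \<pi>"
  shows "p @ \<sigma> \<simeq> p"
proof -
  have "finite {i. EL i \<in> set p}"
  proof (rule finite_subset)
    show "{i. EL i \<in> set p} \<subseteq> {1..n}" using assms(1) by auto
  qed simp
  from this assms(2) have "\<forall>\<sigma> \<in> lists (SL ` {1..<n}). perm \<sigma> = \<pi> \<longrightarrow> p @ \<sigma> \<simeq> p"
  proof (induction rule: permutes_rev_induct)
    case id
    show ?case
    proof (intro ballI impI)
      fix \<sigma> :: "'x letter list" assume "\<sigma> \<in> lists (SL ` {1..<n})" "perm \<sigma> = id"
      then have "\<sigma> \<simeq> []" by (intro identity_word[OF _ order_refl])
      then have "p @ \<sigma> \<simeq> p @ []" using assms(1) by (intro eqv_append_left diagonal_words)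
      then show "p @ \<sigma> \<simeq> p" by simp
    qed
  next
    case (swap a b \<pi>)
    show ?case
    proof (intro ballI impI)
      fix \<sigma> :: "'x letter list"
      assume \<sigma>: "\<sigma> \<in> lists (SL ` {1..<n})" "perm \<sigma> = \<pi> \<circ> transpose a b"
      obtain \<tau> where \<tau>: "\<tau> \<in> lists (SL ` {1..<n})" "perm \<tau> = transpose a b" "p @ \<tau> \<simeq> p"
        using absorbs_transposition[OF assms(1), of a b] swap.hyps by blast
      have "perm (\<tau> @ \<sigma>) = \<pi>"
        by (simp add: perm_append \<sigma> \<tau> comp_assoc)
      then have abs: "p @ (\<tau> @ \<sigma>) \<simeq> p" using swap.IH \<sigma>(1) \<tau>(1) by simp
      have "p @ \<sigma> \<simeq> (p @ \<tau>) @ \<sigma>"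
        using \<tau>(3) SL_words[OF \<sigma>(1)] by (intro eqv_append_right eqv_sym[OF \<tau>(3)]) simp
      also have "(p @ \<tau>) @ \<sigma> = p @ (\<tau> @ \<sigma>)" by simp
      also note abs
      finally show "p @ \<sigma> \<simeq> p" .
    qed
  qed
  then show ?thesis using assms(3,4) by blast
qed


section \<open>Completeness of the relations\<close>

text \<open>The effect on a diagonal letter of moving \<^term>\<open>SL i\<close> across it, for
  \<open>f = transpose i (i + 1)\<close>.\<close>

fun relabel :: "(nat \<Rightarrow> nat) \<Rightarrow> 'y letter \<Rightarrow> 'y letter" where
  "relabel f (SL i) = SL i"
| "relabel f (EL i) = EL (f i)"
| "relabel f (XL x i) = XL x (f i)"

text \<open>For \<^term>\<open>position l = i + 1\<close> no relation applies directly. The relation for position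
  \<^term>\<open>i\<close> is then read from right to left and conjugated by the involution \<^term>\<open>SL i\<close>.\<close>

lemma slide_letter:
  assumes "i \<in> {1..<n}" and "l \<in> diagonal_alphabet n X"
  defines "l' \<equiv> relabel (transpose i (i + 1)) l"
  shows "l' \<in> diagonal_alphabet n X" and "[SL i, l] \<simeq> [l', SL i]"
proof -
  have range: "transpose i (i + 1) j \<in> {1..n}" if "j \<in> {1..n}" for j
    using that assms(1) by (simp add: transpose_def)
  show l': "l' \<in> diagonal_alphabet n X"
    using assms(2) by (cases l rule: diagonal_cases) (use range in \<open>simp_all add: l'_def\<close>)
  have "position l = i \<or> position l = i + 1 \<or> position l \<noteq> i \<and> position l \<noteq> i + 1" by blast
  then show "[SL i, l] \<simeq> [l', SL i]"
  proof (elim disjE)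
    assume "position l \<noteq> i \<and> position l \<noteq> i + 1"
    then have p: "position l \<noteq> i" "position l \<noteq> i + 1" by auto
    from assms(2) show ?thesis
    proof (cases l rule: diagonal_cases)
      case (E j)
      then have "l' = EL j" using p by (simp add: l'_def transpose_def)
      moreover have "[SL i, EL j] \<simeq> [EL j, SL i]"
        using E p assms(1) by (intro eqv_relation R6) simp_all
      ultimately show ?thesis using E by simp
    next
      case (X x j)
      then have "l' = XL x j" using p by (simp add: l'_def transpose_def)
      moreover have "[SL i, XL x j] \<simeq> [XL x j, SL i]"
        using X p assms(1) by (intro eqv_relation R11) simp_all
      ultimately show ?thesis using X by simp
    qed
  next
    assume "position l = i"
    with assms(2) show ?thesis
      using eqv_relation[OF R7[OF assms(1)]] eqv_relation[OF R12[OF _ assms(1)]]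
      by (cases l rule: diagonal_cases) (simp_all add: l'_def)
  next
    assume p: "position l = i + 1"
    have moved: "[SL i, l'] \<simeq> [l, SL i]"
      using assms(2)
    proof (cases l rule: diagonal_cases)
      case (E j)
      then show ?thesis using p eqv_relation[OF R7[OF assms(1)]] by (simp add: l'_def)
    next
      case (X x j)
      then show ?thesis using p eqv_relation[OF R12[OF _ assms(1)]] by (simp add: l'_def)
    qed
    have S: "[SL i] \<in> words" and lw: "[l] \<in> words" and lw': "[l'] \<in> words"
      using assms(1,2) l' by (auto simp: diagonal_alphabet_def)
    have SS: "[SL i, SL i] \<simeq> []" by (rule eqv_relation[OF R1[OF assms(1)]])
    have "[SL i, l] @ [] \<simeq> [SL i, l] @ [SL i, SL i]"
      using S lw by (intro eqv_append_left eqv_sym[OF SS]) simp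
    also have "[SL i, l] @ [SL i, SL i] = [SL i] @ [l, SL i] @ [SL i]" by simp
    also have "\<dots> \<simeq> [SL i] @ [SL i, l'] @ [SL i]"
      using S by (intro eqv_in_context eqv_sym[OF moved])
    also have "\<dots> = [SL i, SL i] @ [l', SL i]" by simp
    also have "\<dots> \<simeq> [] @ [l', SL i]"
      using S lw' by (intro eqv_append_right SS) simp
    finally show ?thesis by simp
  qed
qed

lemma slide_word:
  assumes "i \<in> {1..<n}" and "p \<in> diagonal"
  shows "\<exists>q \<in> diagonal. [SL i] @ p \<simeq> q @ [SL i]"
  using assms(2)
proof (induction p)
  case Nil
  show ?case using assms(1) by (intro bexI[of _ "[]"]) (simp_all add: eqv_refl)
next
  case (Cons l p)
  then have p: "p \<in> words" using diagonal_words by blast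
  from Cons obtain q where q: "q \<in> diagonal" "[SL i] @ p \<simeq> q @ [SL i]" by blast
  define l' where "l' = relabel (transpose i (i + 1)) l"
  have l': "l' \<in> diagonal_alphabet n X" "[SL i, l] \<simeq> [l', SL i]"
    using slide_letter[OF assms(1)] Cons.hyps by (simp_all add: l'_def)
  have "[SL i, l] @ p \<simeq> [l', SL i] @ p"
    using l'(2) p by (rule eqv_append_right)
  also have "\<dots> = [l'] @ ([SL i] @ p)" by simp
  also have "\<dots> \<simeq> [l'] @ (q @ [SL i])"
    using q(2) l'(1) by (intro eqv_append_left diagonal_words) simp_all
  finally have "[SL i] @ (l # p) \<simeq> (l' # q) @ [SL i]" by simp
  moreover have "l' # q \<in> diagonal" using l'(1) q(1) by simp
  ultimately show ?case by (intro bexI)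
qed

lemma factorization:
  assumes "w \<in> words"
  shows "\<exists>p \<in> diagonal. \<exists>\<sigma> \<in> lists (SL ` {1..<n}). w \<simeq> p @ \<sigma>"
  using assms
proof (induction w)
  case Nil
  show ?case by (intro bexI[of _ "[]"]) (simp_all add: eqv_refl)
next
  case (Cons l w)
  then obtain p \<sigma> where IH: "p \<in> diagonal" "\<sigma> \<in> lists (SL ` {1..<n})" "w \<simeq> p @ \<sigma>" by blast
  have "[l] @ w \<simeq> [l] @ (p @ \<sigma>)"
    using IH(3) Cons.hyps(1) by (intro eqv_append_left) simp_all
  then have w: "l # w \<simeq> l # p @ \<sigma>" by simp
  show ?case
  proof (cases "l \<in> range SL")
    case False
    then have "l # p \<in> diagonal" using Cons.hyps IH(1) by (simp add: diagonal_alphabet_def)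
    moreover have "l # w \<simeq> (l # p) @ \<sigma>" using w by simp
    ultimately show ?thesis using IH(2) by blast
  next
    case True
    then obtain i where l: "l = SL i" "i \<in> {1..<n}" using Cons.hyps(1) by auto
    from slide_word[OF l(2) IH(1)] obtain q where q: "q \<in> diagonal" "[SL i] @ p \<simeq> q @ [SL i]" by blast
    have "([SL i] @ p) @ \<sigma> \<simeq> (q @ [SL i]) @ \<sigma>"
      using q(2) SL_words[OF IH(2)] by (intro eqv_append_right) simp_all
    with w have "l # w \<simeq> q @ (SL i # \<sigma>)" using l(1) eqv_trans by simp
    moreover have "SL i # \<sigma> \<in> lists (SL ` {1..<n})" using l(2) IH(2) by simp
    ultimately show ?thesis using q(1) by blast
  qed
qed

text \<open>Both words are factorized. Equality of the images says that the diagonal parts cut the same positions, that their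
  coordinates have equal values elsewhere, and that the permutations agree on the uncut
  positions.\<close>

lemma equivalent_if_same_image:
  assumes "u \<in> words" and "v \<in> words" and "wreath_map M n \<phi> u = wreath_map M n \<phi> v"
  shows "u \<simeq> v"
proof -
  obtain p \<sigma> where u: "p \<in> diagonal" "\<sigma> \<in> lists (SL ` {1..<n})" "u \<simeq> p @ \<sigma>"
    using factorization[OF assms(1)] by blast
  obtain q \<tau> where v: "q \<in> diagonal" "\<tau> \<in> lists (SL ` {1..<n})" "v \<simeq> q @ \<tau>"
    using factorization[OF assms(2)] by blast
  have "wreath_map M n \<phi> (p @ \<sigma>) = wreath_map M n \<phi> (q @ \<tau>)"
    using eqv_sound[OF u(3)] eqv_sound[OF v(3)] assms(3) by simp
  then have strands: "map_option (map_prod \<phi> id) (strand (p @ \<sigma>) i) =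
      map_option (map_prod \<phi> id) (strand (q @ \<tau>) i)" if "i \<in> {1..n}" for i
    using wreath_map_eq_iff eqv_words(2)[OF u(3)] eqv_words(2)[OF v(3)] that by blast
  have supp: "EL i \<in> set p \<longleftrightarrow> EL i \<in> set q"
    and coord: "EL i \<notin> set p \<Longrightarrow> \<phi> (coordinate i p) = \<phi> (coordinate i q) \<and> perm \<sigma> i = perm \<tau> i"
    if "i \<in> {1..n}" for i
    using strands[OF that] unfolding strand_diagonal_perm[OF u(1,2)] strand_diagonal_perm[OF v(1,2)]
    by (simp_all split: if_splits)
  have "p \<simeq> q"
  proof (rule diagonal_eqv[OF u(1) v(1)])
    show "\<forall>l \<in> set p \<union> set q. position l \<le> n"
    proof
      fix l assume "l \<in> set p \<union> set q"
      then have "position l \<in> {1..n}" using u(1) v(1) by (intro diagonal_position) auto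
      then show "position l \<le> n" by simp
    qed
  qed (use supp coord in blast)
  have w: "p \<in> words" "q \<in> words" "\<sigma> \<in> words" "\<tau> \<in> words"
    using u v diagonal_words SL_words by blast+
  have rev: "rev \<tau> \<in> lists (SL ` {1..<n})" using v(2) by (simp add: in_lists_conv_set)
  have "perm (\<sigma> @ rev \<tau>) permutes {i. EL i \<in> set q}"
  proof (rule permutes_superset)
    show "perm (\<sigma> @ rev \<tau>) permutes {1..n}"
      using u(2) rev by (intro perm_permutes) simp
    fix i assume i: "i \<in> {1..n} - {i. EL i \<in> set q}"
    then have "perm \<sigma> i = perm \<tau> i" using supp coord by blast
    then have "perm (\<sigma> @ rev \<tau>) i = perm (\<tau> @ rev \<tau>) i" by (simp add: perm_append)
    also have "\<dots> = i" by (simp only: perm_append_rev[OF v(2)] id_apply)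
    finally show "perm (\<sigma> @ rev \<tau>) i = i" .
  qed
  \<comment> \<open>In the group, \<open>\<sigma> = (\<sigma> \<tau>\<^sup>-\<^sup>1) \<tau>\<close>, and \<open>rev \<tau>\<close> is a word for the inverse of \<open>\<tau>\<close>.\<close>
  then have absorb: "q @ (\<sigma> @ rev \<tau>) \<simeq> q"
    using u(2) rev by (intro absorbs_permutation[OF v(1)]) simp_all
  have cancel: "rev \<tau> @ \<tau> \<simeq> []" using cancel_rev[OF rev] by simp
  note u(3)
  also have "p @ \<sigma> \<simeq> q @ \<sigma>" using \<open>p \<simeq> q\<close> w by (intro eqv_append_right)
  also have "q @ \<sigma> = (q @ \<sigma>) @ []" by simp
  also have "\<dots> \<simeq> (q @ \<sigma>) @ (rev \<tau> @ \<tau>)"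
    using w by (intro eqv_append_left eqv_sym[OF cancel]) simp
  also have "\<dots> = (q @ (\<sigma> @ rev \<tau>)) @ \<tau>" by simp
  also have "\<dots> \<simeq> q @ \<tau>" using absorb w by (intro eqv_append_right)
  also have "q @ \<tau> \<simeq> v" using v(3) by (rule eqv_sym)
  finally show ?thesis .
qed


section \<open>Surjectivity\<close>

lemma diagonal_word_with_coordinates:
  assumes "\<forall>i\<in>{1..n}. a i \<in> insert None (Some ` carrier M)" and "m \<le> n"
  shows "\<exists>p \<in> diagonal. (\<forall>l\<in>set p. position l \<le> m) \<and>
    (\<forall>i\<in>{1..m}. if EL i \<in> set p then a i = None else a i = Some (\<phi> (coordinate i p)))"
  using assms(2)
proof (induction m)
  case 0
  show ?case by (rule bexI[of _ "[]"]) simp_all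
next
  case (Suc m)
  then obtain p where p: "p \<in> diagonal" "\<forall>l\<in>set p. position l \<le> m"
    "\<forall>i\<in>{1..m}. if EL i \<in> set p then a i = None else a i = Some (\<phi> (coordinate i p))"
    by auto
  have fresh: "EL (Suc m) \<notin> set p" "coordinate (Suc m) p = []"
    using p(2) by (fastforce intro: coordinate_eq_Nil)+
  obtain w where w: "w \<in> diagonal" "\<forall>l\<in>set w. position l = Suc m"
    "if EL (Suc m) \<in> set w then a (Suc m) = None else a (Suc m) = Some (\<phi> (coordinate (Suc m) w))"
  proof (cases "a (Suc m)")
    case None
    then show ?thesis using Suc.prems by (intro that[of "[EL (Suc m)]"]) simp_all
  next
    case (Some y)
    have "a (Suc m) \<in> insert None (Some ` carrier M)" using assms(1) Suc.prems by simp
    then have "y \<in> \<phi> ` lists X" using Some \<phi>_surj by auto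
    then obtain u where u: "u \<in> lists X" "\<phi> u = y" by blast
    show ?thesis
    proof (rule that[of "word_at (Suc m) u"])
      show "word_at (Suc m) u \<in> diagonal"
        using u(1) Suc.prems by (auto simp: word_at_def)
      show "\<forall>l\<in>set (word_at (Suc m) u). position l = Suc m"
        by (auto simp: word_at_def)
      have "EL (Suc m) \<notin> set (word_at (Suc m) u)" by (auto simp: word_at_def)
      then show "if EL (Suc m) \<in> set (word_at (Suc m) u) then a (Suc m) = None
          else a (Suc m) = Some (\<phi> (coordinate (Suc m) (word_at (Suc m) u)))"
        using Some u by (simp add: coordinate_word_at)
    qed
  qed
  have other: "EL i \<notin> set w" "coordinate i w = []" if "i \<noteq> Suc m" for i
    using w(2) that by (fastforce intro: coordinate_eq_Nil)+
  show ?case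
  proof (intro bexI[of _ "p @ w"] conjI ballI)
    show "p @ w \<in> diagonal" using p(1) w(1) by simp
    show "position l \<le> Suc m" if "l \<in> set (p @ w)" for l
      using that p(2) w(2) by fastforce
    show "if EL i \<in> set (p @ w) then a i = None else a i = Some (\<phi> (coordinate i (p @ w)))"
      if "i \<in> {1..Suc m}" for i
    proof (cases "i = Suc m")
      case True
      then show ?thesis using fresh w(3) by (simp add: coordinate_append)
    next
      case False
      then have "i \<in> {1..m}" using that by simp
      then show ?thesis using p(3) other[OF False] by (simp add: coordinate_append)
    qed
  qed
qed

text \<open>The complements of the domain and the range have the same number of elements, so a bijection
  between them completes the partial injection.\<close>

lemma extend_to_permutation:
  assumes "finite S" and "dom \<alpha> \<subseteq> S" and "ran \<alpha> \<subseteq> S" and "inj_on \<alpha> (dom \<alpha>)"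
  shows "\<exists>\<pi>. \<pi> permutes S \<and> (\<forall>i j. \<alpha> i = Some j \<longrightarrow> \<pi> i = j)"
proof -
  have fin: "finite (dom \<alpha>)" using assms(1,2) by (rule rev_finite_subset)
  have inj: "inj_on (the \<circ> \<alpha>) (dom \<alpha>)"
    using assms(4) by (auto simp: inj_on_def dom_def)
  have img: "(the \<circ> \<alpha>) ` dom \<alpha> = ran \<alpha>"
    by (force simp: ran_def dom_def)
  have "card (dom \<alpha>) = card (ran \<alpha>)"
    using card_image[OF inj] img by simp
  then have "card (S - dom \<alpha>) = card (S - ran \<alpha>)"
    using assms(1-3) by (simp add: card_Diff_subset finite_subset)
  then obtain g where g: "bij_betw g (S - dom \<alpha>) (S - ran \<alpha>)"
    using assms(1) finite_same_card_bij by blast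
  define \<pi> where "\<pi> i = (case \<alpha> i of Some j \<Rightarrow> j | None \<Rightarrow> if i \<in> S then g i else i)" for i
  have "bij_betw \<pi> (dom \<alpha>) (ran \<alpha>)"
    using bij_betw_imageI[OF inj img] by (rule bij_betw_cong[THEN iffD1, rotated]) (auto simp: \<pi>_def)
  moreover have "bij_betw \<pi> (S - dom \<alpha>) (S - ran \<alpha>)"
    using g by (rule bij_betw_cong[THEN iffD1, rotated]) (auto simp: \<pi>_def dom_def)
  ultimately have "bij_betw \<pi> (dom \<alpha> \<union> (S - dom \<alpha>)) (ran \<alpha> \<union> (S - ran \<alpha>))"
    by (rule bij_betw_combine) blast
  then have "bij_betw \<pi> S S"
    using assms(2,3) by (simp add: Un_absorb1)
  moreover have "\<pi> i = i" if "i \<notin> S" for i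
    using that assms(2) by (auto simp: \<pi>_def split: option.split)
  ultimately have "\<pi> permutes S" by (rule bij_imp_permutes)
  moreover have "\<forall>i j. \<alpha> i = Some j \<longrightarrow> \<pi> i = j" by (simp add: \<pi>_def)
  ultimately show ?thesis by blast
qed

lemma wreath_map_surjective:
  assumes "g \<in> carrier (wreath M n)"
  shows "g \<in> wreath_map M n \<phi> ` words"
proof -
  obtain a \<alpha> where g: "g = (a, \<alpha>)" by fastforce
  have a\<alpha>: "a \<in> extensional {1..n}" "\<forall>i\<in>{1..n}. a i \<in> insert None (Some ` carrier M)"
    "\<forall>i\<in>{1..n}. a i = None \<longleftrightarrow> \<alpha> i = None" "dom \<alpha> \<subseteq> {1..n}" "ran \<alpha> \<subseteq> {1..n}" "inj_on \<alpha> (dom \<alpha>)"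
    using assms unfolding g carrier_wreath_iff by blast+
  obtain p where p: "p \<in> diagonal"
    "\<forall>i\<in>{1..n}. if EL i \<in> set p then a i = None else a i = Some (\<phi> (coordinate i p))"
    using diagonal_word_with_coordinates[OF a\<alpha>(2) order_refl] by (elim bexE conjE) (rule that)
  have pE: "a i = None" if "i \<in> {1..n}" "EL i \<in> set p" for i
    using p(2)[rule_format, OF that(1)] that(2) by (simp only: if_True)
  have pX: "a i = Some (\<phi> (coordinate i p))" if "i \<in> {1..n}" "EL i \<notin> set p" for i
    using p(2)[rule_format, OF that(1)] that(2) by (simp only: if_False)
  obtain \<pi> where \<pi>: "\<pi> permutes {1..n}" "\<forall>i j. \<alpha> i = Some j \<longrightarrow> \<pi> i = j"
    using extend_to_permutation[OF finite_atLeastAtMost a\<alpha>(4-6)] by (elim exE conjE) (rule that)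
  obtain \<sigma> :: "'x letter list" where \<sigma>: "\<sigma> \<in> lists (SL ` {1..<n})" "perm \<sigma> = \<pi>"
    using permutation_word[OF \<pi>(1)] by blast
  have w: "p @ \<sigma> \<in> words" using diagonal_words[OF p(1)] SL_words[OF \<sigma>(1)] by simp
  have "wreath_map M n \<phi> (p @ \<sigma>) = (a, \<alpha>)"
    unfolding wreath_map_eq_strand[OF monoid \<phi>_hom w]
  proof (intro arg_cong2[where f = Pair] ext)
    fix i
    show "(\<lambda>i\<in>{1..n}. map_option (\<phi> \<circ> fst) (strand (p @ \<sigma>) i)) i = a i"
    proof (cases "i \<in> {1..n}")
      case True
      show ?thesis
        using pE[OF True] pX[OF True] unfolding strand_diagonal_perm[OF p(1) \<sigma>(1)] restrict_apply'[OF True]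
        by (cases "EL i \<in> set p") simp_all
    next
      case False
      then show ?thesis using extensional_arb[OF a\<alpha>(1) False] by (simp only: restrict_apply if_False)
    qed
    show "(if i \<in> {1..n} then map_option snd (strand (p @ \<sigma>) i) else None) = \<alpha> i"
    proof (cases "i \<in> {1..n}")
      case True
      show ?thesis
      proof (cases "\<alpha> i")
        case None
        then have "a i = None" using a\<alpha>(3) True by blast
        then have "EL i \<in> set p" using pX[OF True] by (cases "EL i \<in> set p") simp_all
        then show ?thesis using None strand_diagonal_perm[OF p(1) \<sigma>(1)] by simp
      next
        case (Some j)
        then have "a i \<noteq> None" using a\<alpha>(3) True by auto
        then have "EL i \<notin> set p" using pE[OF True] by (cases "EL i \<in> set p") simp_all
        moreover have "\<pi> i = j" using \<pi>(2) Some by blast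
        ultimately show ?thesis using Some True strand_diagonal_perm[OF p(1) \<sigma>(1)] \<sigma>(2) by simp
      qed
    next
      case False
      then have "i \<notin> dom \<alpha>" using a\<alpha>(4) by (rule contra_subsetD[rotated])
      then have "\<alpha> i = None" by (simp add: domIff)
      with False show ?thesis by (simp only: if_False)
    qed
  qed
  then have "g = wreath_map M n \<phi> (p @ \<sigma>)" unfolding g by (rule sym)
  then show ?thesis using w by (rule image_eqI[where f = "wreath_map M n \<phi>"])
qed

lemma wreath_has_presentation:
  "has_presentation (wreath M n) (wreath_alphabet n X) (wreath_relations n X R) (wreath_map M n \<phi>)"
  unfolding has_presentation_def
proof (intro conjI)
  show "monoid (wreath M n)" by (rule monoid_wreath[OF monoid])
  show "wreath_relations n X R \<subseteq> words \<times> words" by (rule wreath_relations_in_lists[OF relators])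
  show "wreath_map M n \<phi> \<in> monoid_hom (free_monoid (wreath_alphabet n X)) (wreath M n)"
    by (rule wreath_map_hom)
  then have "wreath_map M n \<phi> ` words \<subseteq> carrier (wreath M n)"
    by (auto simp: monoid_hom_def hom_def carrier_free_monoid)
  then show "wreath_map M n \<phi> ` words = carrier (wreath M n)"
    using wreath_map_surjective by blast
  show "monoid_kernel (free_monoid (wreath_alphabet n X)) (wreath_map M n \<phi>) =
      generated_congruence (free_monoid (wreath_alphabet n X)) (wreath_relations n X R)"
  proof (intro equalityI subrelI)
    fix u v
    assume "(u, v) \<in> monoid_kernel (free_monoid (wreath_alphabet n X)) (wreath_map M n \<phi>)"
    then have "u \<simeq> v" by (intro equivalent_if_same_image) (simp_all add: monoid_kernel_def carrier_free_monoid)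
    then show "(u, v) \<in> generated_congruence (free_monoid (wreath_alphabet n X)) (wreath_relations n X R)"
      by (simp only: equivalent_def)
  next
    fix u v
    assume "(u, v) \<in> generated_congruence (free_monoid (wreath_alphabet n X)) (wreath_relations n X R)"
    then have "u \<simeq> v" by (simp only: equivalent_def)
    then show "(u, v) \<in> monoid_kernel (free_monoid (wreath_alphabet n X)) (wreath_map M n \<phi>)"
      using eqv_words eqv_sound by (simp add: monoid_kernel_def carrier_free_monoid)
  qed
qed

end


theorem theorem3p22:
  fixes M :: "('m, 'k) monoid_scheme"
    and X\<^sub>M :: "'x set"
    and R\<^sub>M :: "('x list \<times> 'x list) set"
    and \<phi>\<^sub>M :: "'x list \<Rightarrow> 'm"
    and n :: nat
  assumes "monoid M"
    and "has_presentation M X\<^sub>M R\<^sub>M \<phi>\<^sub>M"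
  shows "has_presentation (wreath M n)
           (wreath_alphabet n X\<^sub>M) (wreath_relations n X\<^sub>M R\<^sub>M) (wreath_map M n \<phi>\<^sub>M)"
  using wreath_presentation.wreath_has_presentation[OF wreath_presentation.intro[OF assms]] .

end
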